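(* Let $X$ be a complex Banach space and $T\in\mathcal{B}(X)$. The following statements are equivalent: 1) $\sigma_{lf}(T)=\sigma_{lB}(T)$; 2) $T^*$ has SVEP at every $\lambda\notin\sigma_{lf}(T)$; 3) $T^*$ has SVEP at every $\lambda\notin\sigma_{plBF}(T)$; 4) $\sigma_{gD\mathcal{Q}}(T)=\sigma_{plBF}(T)$.
   Context: $\mathcal{B}(X)$ is the algebra of bounded linear operators on $X$; $T^*$ is the adjoint of $T$ acting on the dual space $X^*$; $R(T)$ is the range. $(M,N)\in Red(T)$ means that $M,N$ are closed $T$-invariant subspaces with $X=M\oplus N$. $T$ is lower semi-Fredholm if $\operatorname{codim}R(T)<\infty$. The descent is $d(T)=\min\{q: R(T^q)=R(T^{q+1})\}$ ($\infty$ if no such $q$). $T$ is lower semi-Browder if it is lower semi-Fredholm with $d(T)<\infty$. $T$ is pseudo lower B-Fredholm (resp. generalized Drazin surjective) if there exists $(M,N)\in Red(T)$ such that $T_{|M}$ is lower semi-Fredholm (resp. surjective) and $T_{|N}$ is quasi-nilpotent. The sets of $\lambda\in\mathbb{C}$ such that $T-\lambda I$ is not lower semi-Fredholm, lower semi-Browder, pseudo lower B-Fredholm, generalized Drazin surjective are denoted $\sigma_{lf}(T)$, $\sigma_{lB}(T)$, $\sigma_{plBF}(T)$, $\sigma_{gD\mathcal{Q}}(T)$, respectively. An operator $S$ on a complex Banach space $Y$ has SVEP (the single valued extension property) at $\lambda_0\in\mathbb{C}$ if for every connected open neighbourhood $U$ of $\lambda_0$ the only analytic function $f:U\to Y$ with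 $(S-zI)f(z)=0$ for all $z\in U$ is $f\equiv 0$. *)

theory Defs
  imports "HOL-Analysis.Analysis" "HOL-Library.Extended_Nat"
begin

section \<open>Complex Banach spaces\<close>

class scaleC = scaleR +
  fixes scaleC :: "complex \<Rightarrow> 'a \<Rightarrow> 'a"  (infixr "*\<^sub>C" 75)

text \<open>The real Banach space structure is the restriction of scalars of the complex one.\<close>

class complex_banach = banach + scaleC +
  assumes scaleC_add_right: "a *\<^sub>C (x + y) = a *\<^sub>C x + a *\<^sub>C y"
    and scaleC_add_left: "(a + b) *\<^sub>C x = a *\<^sub>C x + b *\<^sub>C x"
    and scaleC_scaleC: "a *\<^sub>C (b *\<^sub>C x) = (a * b) *\<^sub>C x"
    and scaleC_one: "1 *\<^sub>C x = x"
    and scaleR_scaleC: "r *\<^sub>R x = complex_of_real r *\<^sub>C x"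
    and norm_scaleC: "norm (a *\<^sub>C x) = cmod a * norm x"

global_interpretation complex_vector: vector_space "scaleC :: complex \<Rightarrow> 'a \<Rightarrow> 'a::complex_banach"
  by unfold_locales (simp_all add: scaleC_add_right scaleC_add_left scaleC_scaleC scaleC_one)

instantiation complex :: complex_banach
begin

definition scaleC_complex_def: "a *\<^sub>C (x::complex) = a * x"

instance
  by standard (simp_all add: scaleC_complex_def algebra_simps norm_mult scaleR_conv_of_real)

end

definition bounded_clinear :: "('a::complex_banach \<Rightarrow> 'b::complex_banach) \<Rightarrow> bool" where
  "bounded_clinear T \<longleftrightarrow> bounded_linear T \<and> (\<forall>c x. T (c *\<^sub>C x) = c *\<^sub>C T x)"


section \<open>The dual space and the adjoint\<close>

lemma bounded_clinear_blinfun_apply_iff: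
  fixes f :: "'a::complex_banach \<Rightarrow>\<^sub>L complex"
  shows "bounded_clinear (blinfun_apply f) \<longleftrightarrow> (\<forall>c x. blinfun_apply f (c *\<^sub>C x) = c * blinfun_apply f x)"
  by (simp add: bounded_clinear_def scaleC_complex_def blinfun.bounded_linear_right)

text \<open>Complex-linear bounded functionals, with the operator norm inherited from the space of
  real-linear bounded maps into the complex numbers.\<close>

typedef (overloaded) ('a::complex_banach) cdual =
  "{f :: 'a \<Rightarrow>\<^sub>L complex. bounded_clinear (blinfun_apply f)}"
  morphisms blinfun_of_cdual cdual_of_blinfun
  by (rule exI[of _ 0]) (simp add: bounded_clinear_blinfun_apply_iff)

setup_lifting type_definition_cdual

lift_definition cdual_apply :: "'a::complex_banach cdual \<Rightarrow> 'a \<Rightarrow> complex" is blinfun_apply .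

lemma bounded_clinear_cdual_apply: "bounded_clinear (cdual_apply f)"
  by transfer

lemma cdual_eqI: "(\<And>x. cdual_apply f x = cdual_apply g x) \<Longrightarrow> f = g"
  by transfer (rule blinfun_eqI)

instantiation cdual :: (complex_banach) real_normed_vector
begin

lift_definition zero_cdual :: "'a cdual" is 0
  by (simp add: bounded_clinear_blinfun_apply_iff blinfun.bilinear_simps algebra_simps)

lift_definition plus_cdual :: "'a cdual \<Rightarrow> 'a cdual \<Rightarrow> 'a cdual" is "(+)"
  by (simp add: bounded_clinear_blinfun_apply_iff blinfun.bilinear_simps algebra_simps)

lift_definition minus_cdual :: "'a cdual \<Rightarrow> 'a cdual \<Rightarrow> 'a cdual" is "(-)"
  by (simp add: bounded_clinear_blinfun_apply_iff blinfun.bilinear_simps algebra_simps)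

lift_definition uminus_cdual :: "'a cdual \<Rightarrow> 'a cdual" is uminus
  by (simp add: bounded_clinear_blinfun_apply_iff blinfun.bilinear_simps algebra_simps)

lift_definition scaleR_cdual :: "real \<Rightarrow> 'a cdual \<Rightarrow> 'a cdual" is scaleR
  by (simp add: bounded_clinear_blinfun_apply_iff blinfun.bilinear_simps algebra_simps)

lift_definition norm_cdual :: "'a cdual \<Rightarrow> real" is norm .

definition dist_cdual :: "'a cdual \<Rightarrow> 'a cdual \<Rightarrow> real"
  where "dist_cdual f g = norm (f - g)"

definition sgn_cdual :: "'a cdual \<Rightarrow> 'a cdual"
  where "sgn_cdual f = scaleR (inverse (norm f)) f"

definition uniformity_cdual :: "('a cdual \<times> 'a cdual) filter"
  where "uniformity_cdual = (INF e\<in>{0 <..}. principal {(f, g). dist f g < e})"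

definition open_cdual :: "'a cdual set \<Rightarrow> bool"
  where "open_cdual U = (\<forall>x\<in>U. \<forall>\<^sub>F (x', y) in uniformity. x' = x \<longrightarrow> y \<in> U)"

instance
proof
  fix f g :: "'a cdual"
  show "dist f g = norm (f - g)" by (rule dist_cdual_def)
  show "sgn f = scaleR (inverse (norm f)) f" by (rule sgn_cdual_def)
  show "norm (f + g) \<le> norm f + norm g" by transfer (rule norm_triangle_ineq)
qed (rule uniformity_cdual_def open_cdual_def | (transfer, simp add: algebra_simps))+

end

lemma cdual_apply_add: "cdual_apply (f + g) x = cdual_apply f x + cdual_apply g x"
  by transfer (simp add: plus_blinfun.rep_eq)

lemma norm_cdual_onorm: "norm f = onorm (cdual_apply f)"
  by transfer (rule norm_blinfun.rep_eq)

lemma dist_blinfun_of_cdual: "dist (blinfun_of_cdual f) (blinfun_of_cdual g) = dist f g"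
  by (simp add: dist_norm norm_cdual.rep_eq minus_cdual.rep_eq)

instance cdual :: (complex_banach) banach
proof
  fix F :: "nat \<Rightarrow> 'a cdual"
  assume "Cauchy F"
  then have "Cauchy (\<lambda>n. blinfun_of_cdual (F n))"
    by (simp add: Cauchy_def dist_blinfun_of_cdual)
  then obtain g where g: "(\<lambda>n. blinfun_of_cdual (F n)) \<longlonglongrightarrow> g"
    by (auto simp: Cauchy_convergent_iff convergent_def)
  have lim: "(\<lambda>n. cdual_apply (F n) x) \<longlonglongrightarrow> blinfun_apply g x" for x
    unfolding cdual_apply.rep_eq by (intro blinfun.tendsto g tendsto_const)
  have "blinfun_apply g (c *\<^sub>C x) = c *\<^sub>C blinfun_apply g x" for c x
  proof (rule LIMSEQ_unique[OF lim])
    have "cdual_apply (F n) (c *\<^sub>C x) = c * cdual_apply (F n) x" for n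
      using bounded_clinear_cdual_apply[of "F n"]
      by (simp add: bounded_clinear_def scaleC_complex_def)
    then show "(\<lambda>n. cdual_apply (F n) (c *\<^sub>C x)) \<longlonglongrightarrow> c *\<^sub>C blinfun_apply g x"
      by (simp add: scaleC_complex_def tendsto_mult_left lim)
  qed
  then have "bounded_clinear (blinfun_apply g)"
    by (simp add: bounded_clinear_def blinfun.bounded_linear_right)
  then have "blinfun_of_cdual (cdual_of_blinfun g) = g"
    by (simp add: cdual_of_blinfun_inverse)
  with g have "F \<longlonglongrightarrow> cdual_of_blinfun g"
    by (simp add: tendsto_iff flip: dist_blinfun_of_cdual)
  then show "convergent F"
    by (rule convergentI)
qed

instantiation cdual :: (complex_banach) complex_banach
begin

lift_definition scaleC_cdual :: "complex \<Rightarrow> 'a cdual \<Rightarrow> 'a cdual"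
  is "\<lambda>c f. blinfun_compose (blinfun_mult_right c) f"
  by (simp add: bounded_clinear_blinfun_apply_iff algebra_simps)

lemma cdual_apply_scaleC: "cdual_apply (c *\<^sub>C f) x = c * cdual_apply f x"
  by transfer simp

instance
proof
  fix a b :: complex and f g :: "'a cdual" and r :: real
  show "a *\<^sub>C (f + g) = a *\<^sub>C f + a *\<^sub>C g"
    by transfer (rule blinfun_eqI, simp add: plus_blinfun.rep_eq algebra_simps)
  show "(a + b) *\<^sub>C f = a *\<^sub>C f + b *\<^sub>C f"
    by transfer (rule blinfun_eqI, simp add: plus_blinfun.rep_eq algebra_simps)
  show "a *\<^sub>C b *\<^sub>C f = (a * b) *\<^sub>C f"
    by transfer (rule blinfun_eqI, simp)
  show "1 *\<^sub>C f = f"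
    by transfer (rule blinfun_eqI, simp)
  show "r *\<^sub>R f = complex_of_real r *\<^sub>C f"
    by transfer (rule blinfun_eqI, simp add: scaleR_blinfun.rep_eq scaleR_conv_of_real)
  show "norm (a *\<^sub>C f) = cmod a * norm f"
  proof -
    have bl: "bounded_linear (cdual_apply f)"
      using bounded_clinear_cdual_apply[of f] by (simp add: bounded_clinear_def)
    have "onorm (\<lambda>x. a * cdual_apply f x) = onorm (\<lambda>x. cmod a *\<^sub>R cdual_apply f x)"
      unfolding onorm_def by (simp add: norm_mult)
    also have "\<dots> = cmod a * onorm (cdual_apply f)"
      using onorm_scaleR[OF bl, of "cmod a"] by simp
    finally show ?thesis
      by (simp add: norm_cdual_onorm cdual_apply_scaleC[abs_def])
  qed
qed

end

text \<open>The Banach space adjoint \<open>T\<^sup>* f = f \<circ> T\<close>; it is meaningful only for bounded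
  complex-linear \<open>T\<close>, see the two lemmas below.\<close>

definition cadjoint :: "('a::complex_banach \<Rightarrow> 'b::complex_banach) \<Rightarrow> 'b cdual \<Rightarrow> 'a cdual" where
  "cadjoint T f = cdual_of_blinfun (Blinfun (\<lambda>x. cdual_apply f (T x)))"

lemma cdual_apply_cadjoint:
  assumes "bounded_clinear T"
  shows "cdual_apply (cadjoint T f) x = cdual_apply f (T x)"
proof -
  have bl: "bounded_linear (\<lambda>x. cdual_apply f (T x))"
    using assms bounded_clinear_cdual_apply[of f]
    by (auto simp: bounded_clinear_def intro: bounded_linear_compose)
  moreover have "bounded_clinear (\<lambda>x. cdual_apply f (T x))"
    using bl assms bounded_clinear_cdual_apply[of f] by (simp add: bounded_clinear_def)
  ultimately show ?thesis
    by (simp add: cadjoint_def cdual_apply.rep_eq cdual_of_blinfun_inverse bounded_linear_Blinfun_apply)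
qed

lemma bounded_clinear_cadjoint:
  assumes "bounded_clinear T"
  shows "bounded_clinear (cadjoint T)"
proof -
  have T: "bounded_linear T" using assms by (simp add: bounded_clinear_def)
  have bl: "bounded_linear (cdual_apply f)" for f :: "'b cdual"
    using bounded_clinear_cdual_apply[of f] by (simp add: bounded_clinear_def)
  have "bounded_linear (cadjoint T)"
  proof (rule bounded_linear_intro[where K = "onorm T"])
    fix f g :: "'b cdual" and r :: real
    show "cadjoint T (f + g) = cadjoint T f + cadjoint T g"
      by (rule cdual_eqI) (simp add: cdual_apply_cadjoint[OF assms] cdual_apply_add)
    show "cadjoint T (r *\<^sub>R f) = r *\<^sub>R cadjoint T f"
      by (rule cdual_eqI)
        (simp add: cdual_apply_cadjoint[OF assms] scaleR_scaleC cdual_apply_scaleC)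
    have "norm (cadjoint T f) = onorm (cdual_apply f \<circ> T)"
      by (simp add: norm_cdual_onorm cdual_apply_cadjoint[OF assms, abs_def] comp_def)
    also have "\<dots> \<le> norm f * onorm T"
      unfolding norm_cdual_onorm by (rule onorm_compose[OF bl T])
    finally show "norm (cadjoint T f) \<le> norm f * onorm T" .
  qed
  moreover have "cadjoint T (c *\<^sub>C f) = c *\<^sub>C cadjoint T f" for c f
    by (rule cdual_eqI) (simp add: cdual_apply_cadjoint[OF assms] cdual_apply_scaleC)
  ultimately show ?thesis
    by (simp add: bounded_clinear_def)
qed


section \<open>The single valued extension property\<close>

text \<open>A Banach space valued function is analytic on an open set if it is complex differentiable
  at each of its points.\<close>

definition banach_analytic_on :: "(complex \<Rightarrow> 'a::complex_banach) \<Rightarrow> complex set \<Rightarrow> bool" where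
  "banach_analytic_on f U \<longleftrightarrow> (\<forall>z\<in>U. \<exists>D. (f has_derivative (\<lambda>h. h *\<^sub>C D)) (at z))"

definition has_SVEP_at :: "('a::complex_banach \<Rightarrow> 'a) \<Rightarrow> complex \<Rightarrow> bool" where
  "has_SVEP_at S \<mu> \<longleftrightarrow>
     (\<forall>U f. open U \<and> connected U \<and> \<mu> \<in> U \<and> banach_analytic_on f U \<and>
        (\<forall>z\<in>U. S (f z) - z *\<^sub>C f z = 0) \<longrightarrow> (\<forall>z\<in>U. f z = 0))"


section \<open>Classes of operators and spectra\<close>

text \<open>A property of the restriction \<open>T|\<^sub>M\<close> of \<open>T\<close> to a closed invariant subspace \<open>M\<close> is expressed
  by a predicate with suffix \<open>_on\<close> and a carrier argument \<open>M\<close>.\<close>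

text \<open>The dimension of \<open>M / R\<close>: the least number of vectors of \<open>M\<close> whose classes span the
  quotient, and \<open>\<infinity>\<close> if finitely many do not suffice.\<close>

definition codim_in :: "'a::complex_banach set \<Rightarrow> 'a set \<Rightarrow> enat" where
  "codim_in M R = Inf {enat (card B) |B. finite B \<and> B \<subseteq> M \<and> complex_vector.span (R \<union> B) = M}"

definition lower_semi_Fredholm_on :: "'a::complex_banach set \<Rightarrow> ('a \<Rightarrow> 'a) \<Rightarrow> bool" where
  "lower_semi_Fredholm_on M T \<longleftrightarrow> codim_in M (T ` M) < \<infinity>"

abbreviation lower_semi_Fredholm :: "('a::complex_banach \<Rightarrow> 'a) \<Rightarrow> bool" where
  "lower_semi_Fredholm \<equiv> lower_semi_Fredholm_on UNIV"

definition descent :: "('a \<Rightarrow> 'a) \<Rightarrow> enat" where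
  "descent T = Inf {enat q |q. range (T ^^ q) = range (T ^^ (q + 1))}"

definition lower_semi_Browder :: "('a::complex_banach \<Rightarrow> 'a) \<Rightarrow> bool" where
  "lower_semi_Browder T \<longleftrightarrow> lower_semi_Fredholm T \<and> descent T < \<infinity>"

text \<open>Invertibility of \<open>S|\<^sub>N\<close> in the algebra of bounded operators on \<open>N\<close>. The inverse \<open>V\<close> is
  automatically linear on \<open>N\<close> since \<open>S\<close> is.\<close>

definition invertible_on :: "'a::complex_banach set \<Rightarrow> ('a \<Rightarrow> 'a) \<Rightarrow> bool" where
  "invertible_on N S \<longleftrightarrow>
     (\<exists>V K. \<forall>x\<in>N. S x \<in> N \<and> V x \<in> N \<and> V (S x) = x \<and> S (V x) = x \<and> norm (V x) \<le> K * norm x)"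

definition spectrum_on :: "'a::complex_banach set \<Rightarrow> ('a \<Rightarrow> 'a) \<Rightarrow> complex set" where
  "spectrum_on N T = {\<mu>. \<not> invertible_on N (\<lambda>x. T x - \<mu> *\<^sub>C x)}"

text \<open>The inclusion, rather than equality, accounts for \<open>N = {0}\<close>, where the spectrum is empty.\<close>

definition quasi_nilpotent_on :: "'a::complex_banach set \<Rightarrow> ('a \<Rightarrow> 'a) \<Rightarrow> bool" where
  "quasi_nilpotent_on N T \<longleftrightarrow> spectrum_on N T \<subseteq> {0}"

definition Red :: "('a::complex_banach \<Rightarrow> 'a) \<Rightarrow> ('a set \<times> 'a set) set" where
  "Red T = {(M, N).
     complex_vector.subspace M \<and> closed M \<and> T ` M \<subseteq> M \<and>
     complex_vector.subspace N \<and> closed N \<and> T ` N \<subseteq> N \<and>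
     M \<inter> N = {0} \<and> {x + y |x y. x \<in> M \<and> y \<in> N} = UNIV}"

definition pseudo_lower_B_Fredholm :: "('a::complex_banach \<Rightarrow> 'a) \<Rightarrow> bool" where
  "pseudo_lower_B_Fredholm T \<longleftrightarrow>
     (\<exists>(M, N)\<in>Red T. lower_semi_Fredholm_on M T \<and> quasi_nilpotent_on N T)"

definition generalized_Drazin_surjective :: "('a::complex_banach \<Rightarrow> 'a) \<Rightarrow> bool" where
  "generalized_Drazin_surjective T \<longleftrightarrow>
     (\<exists>(M, N)\<in>Red T. T ` M = M \<and> quasi_nilpotent_on N T)"

definition sigma_lf :: "('a::complex_banach \<Rightarrow> 'a) \<Rightarrow> complex set" where
  "sigma_lf T = {\<mu>. \<not> lower_semi_Fredholm (\<lambda>x. T x - \<mu> *\<^sub>C x)}"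

definition sigma_lB :: "('a::complex_banach \<Rightarrow> 'a) \<Rightarrow> complex set" where
  "sigma_lB T = {\<mu>. \<not> lower_semi_Browder (\<lambda>x. T x - \<mu> *\<^sub>C x)}"

definition sigma_plBF :: "('a::complex_banach \<Rightarrow> 'a) \<Rightarrow> complex set" where
  "sigma_plBF T = {\<mu>. \<not> pseudo_lower_B_Fredholm (\<lambda>x. T x - \<mu> *\<^sub>C x)}"

definition sigma_gDQ :: "('a::complex_banach \<Rightarrow> 'a) \<Rightarrow> complex set" where
  "sigma_gDQ T = {\<mu>. \<not> generalized_Drazin_surjective (\<lambda>x. T x - \<mu> *\<^sub>C x)}"

end

theory Submission
  imports Defs "HOL-Complex_Analysis.Conformal_Mappings"
begin

text \<open>Write \<open>S = T - \<mu>\<close>. All four statements reduce to two facts about one operator \<open>S\<close> with a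
  decomposition \<open>X = M \<oplus> N\<close>, lower semi-Fredholm on \<open>M\<close> and quasi-nilpotent on \<open>N\<close>.

  SVEP of \<open>T\<^sup>*\<close> at \<open>\<mu>\<close> implies finite descent of \<open>S\<close> on \<open>M\<close> (\<open>SVEP_imp_finite_descent_on\<close>). The codimensions of
  \<open>S\<^sup>n\<^sup>+\<^sup>1(M)\<close> in \<open>S\<^sup>n(M)\<close> are eventually constant (\<open>finite_codim_iterates_stabilize\<close>), and on \<open>Y = S\<^sup>m(M)\<close>
  with \<open>m\<close> in the constant range, the kernel of \<open>S\<close> lies in all iterated ranges. If the constant is not
  zero, there are functionals with \<open>\<phi>\<^sub>0 \<circ> S = 0\<close>, \<open>\<phi>\<^sub>n\<^sub>+\<^sub>1 \<circ> S = \<phi>\<^sub>n\<close>, \<open>\<phi>\<^sub>0 \<noteq> 0\<close>, and norms growing at most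
  geometrically (\<open>functional_chain\<close>). Their power series in \<open>z - \<mu>\<close> is a nonzero analytic function
  annihilated by \<open>T\<^sup>* - z\<close>.

  Finite descent on \<open>M\<close> implies that \<open>S\<close> is generalized Drazin surjective
  (\<open>finite_descent_imp_generalized_Drazin_surjective\<close>): \<open>R = S\<^sup>q(M)\<close> satisfies \<open>S(R) = R\<close>, which allows one
  to build an invariant finite-dimensional complement of \<open>R\<close> in \<open>M\<close>; there \<open>S\<close> is nilpotent, so that it can be
  absorbed into \<open>N\<close>. This in turn implies SVEP (\<open>generalized_Drazin_surjective_imp_SVEP\<close>), since
  \<open>S - z\<close> is then surjective for all small nonzero \<open>z\<close>.

  With \<open>M = X\<close> this compares lower semi-Fredholm with lower semi-Browder operators, with general \<open>M\<close> it
  compares pseudo lower B-Fredholm with generalized Drazin surjective ones. The two cases are linked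
  because an operator that is pseudo lower B-Fredholm at \<open>\<mu>\<close> is lower semi-Fredholm at all points of a
  punctured disc around \<open>\<mu>\<close>, and SVEP at points arbitrarily close to \<open>\<mu>\<close> gives SVEP at \<open>\<mu>\<close>.

  The analytic input is the open mapping theorem for closed subspaces.\<close>

section \<open>Surjective operators between closed subspaces\<close>

text \<open>Successive approximation: the error left by one approximate preimage is corrected by the next,
  and the corrections are dominated by a geometric series. This one argument serves twice, to close
  up the conclusion of the Baire category theorem and to see that surjectivity survives small
  perturbations.\<close>

lemma approximate_preimage_imp_preimage:
  fixes A :: "'a::banach \<Rightarrow> 'b::real_normed_vector"
  assumes A: "bounded_linear A" and E: "subspace E" "closed E" and W: "subspace W" and AE: "A ` E \<subseteq> W"
    and K: "\<And>w. w \<in> W \<Longrightarrow> \<exists>e\<in>E. norm e \<le> K * norm w \<and> norm (w - A e) \<le> norm w / 2"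
    and w: "w \<in> W"
  shows "\<exists>e\<in>E. norm e \<le> 2 * K * norm w \<and> A e = w"
proof -
  interpret A: bounded_linear A by fact
  obtain g where g: "\<And>w. w \<in> W \<Longrightarrow> g w \<in> E \<and> norm (g w) \<le> K * norm w \<and> norm (w - A (g w)) \<le> norm w / 2"
    using K by metis
  \<comment> \<open>\<open>v n\<close> is the error left after \<open>n\<close> corrections\<close>
  define v where "v n = ((\<lambda>u. u - A (g u)) ^^ n) w" for n
  have v0: "v 0 = w" and vS: "v (Suc n) = v n - A (g (v n))" for n
    by (simp_all add: v_def)
  have vW: "v n \<in> W" for n
    by (induction n) (use w g AE W in \<open>auto simp: v0 vS intro!: subspace_diff\<close>)
  have nv: "norm (v n) \<le> norm w * (1/2) ^ n" for n
  proof (induction n)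
    case (Suc n)
    have "norm (v (Suc n)) \<le> norm (v n) / 2" using g[OF vW] by (simp add: vS)
    then show ?case using Suc by simp
  qed (simp add: v0)
  have Knn: "K * norm (v n) \<le> K * norm w * (1/2) ^ n" for n
  proof (cases "w = 0")
    case True
    then have "v n = 0" using nv[of n] by simp
    then show ?thesis using True by simp
  next
    case False
    have "0 \<le> K * norm w" using g[OF w] norm_ge_zero order_trans by blast
    then have "0 \<le> K" using False by (simp add: zero_le_mult_iff)
    then show ?thesis using nv[of n] by (simp add: mult_left_mono mult.assoc)
  qed
  have ng: "norm (g (v n)) \<le> K * norm w * (1/2) ^ n" for n
    using g[OF vW[of n]] Knn[of n] by linarith
  have geo: "summable (\<lambda>n. K * norm w * (1/2::real) ^ n)"
    by (intro summable_mult summable_geometric) simp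
  have sn: "summable (\<lambda>n. norm (g (v n)))"
    by (rule summable_comparison_test'[OF geo, of 0]) (use ng in simp)
  have sg: "(\<lambda>n. g (v n)) sums (\<Sum>n. g (v n))"
    using summable_norm_cancel[OF sn] by (rule summable_sums)
  define e where "e = (\<Sum>n. g (v n))"
  have "(\<Sum>i<n. g (v i)) \<in> E" for n
    using E(1) g vW by (intro subspace_sum) auto
  then have "e \<in> E"
    using sg unfolding sums_def e_def by (rule closed_sequentially[OF E(2)])
  moreover have "norm e \<le> 2 * K * norm w"
  proof -
    have "norm e \<le> (\<Sum>n. norm (g (v n)))" unfolding e_def by (rule summable_norm[OF sn])
    also have "\<dots> \<le> (\<Sum>n. K * norm w * (1/2) ^ n)" by (rule suminf_le[OF ng sn geo])
    also have "\<dots> = K * norm w * 2" by (subst suminf_mult) (auto simp: suminf_geometric)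
    finally show ?thesis by (simp add: mult_ac)
  qed
  moreover have "A e = w"
  proof -
    have "(\<Sum>i<n. A (g (v i))) = w - v n" for n
      by (induction n) (auto simp: v0 vS)
    moreover have "v \<longlonglongrightarrow> 0"
    proof (rule Lim_null_comparison)
      show "\<forall>\<^sub>F n in sequentially. norm (v n) \<le> norm w * (1/2) ^ n" using nv by simp
      show "(\<lambda>n. norm w * (1/2::real) ^ n) \<longlonglongrightarrow> 0"
        by (rule tendsto_mult_right_zero) (rule LIMSEQ_realpow_zero; simp)
    qed
    then have "(\<lambda>n. w - v n) \<longlonglongrightarrow> w" by (auto intro: tendsto_eq_intros)
    ultimately have "(\<lambda>n. A (g (v n))) sums w" by (simp add: sums_def)
    moreover have "(\<lambda>n. A (g (v n))) sums A e" unfolding e_def by (rule A.sums[OF sg])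
    ultimately show ?thesis by (rule sums_unique2[symmetric])
  qed
  ultimately show ?thesis by blast
qed

text \<open>The open mapping theorem, for an operator between closed subspaces of Banach spaces. By Baire,
  the closed image of some ball has interior in \<open>W\<close>; subtracting the centre and rescaling gives
  every element an approximate preimage of controlled norm.\<close>

lemma open_mapping_on:
  fixes A :: "'a::banach \<Rightarrow> 'b::banach"
  assumes A: "bounded_linear A" and E: "subspace E" "closed E" and W: "subspace W" "closed W"
    and AE: "A ` E = W"
  shows "\<exists>K>0. \<forall>w\<in>W. \<exists>e\<in>E. norm e \<le> K * norm w \<and> A e = w"
proof -
  interpret A: bounded_linear A by fact
  define C where "C n = A ` (E \<inter> cball 0 (real n))" for n :: nat
  have CW: "C n \<subseteq> W" for n using AE by (auto simp: C_def)
  have "\<exists>n. top_of_set W interior_of closure (C n) \<noteq> {}"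
  proof (rule ccontr)
    assume no: "\<not> ?thesis"
    have "top_of_set W interior_of (\<Union>n. closure (C n)) = {}"
    proof (rule Baire_category_alt)
      show "completely_metrizable_space (top_of_set W) \<or>
          locally_compact_space (top_of_set W) \<and> regular_space (top_of_set W)"
        using completely_metrizable_space_closedin[OF completely_metrizable_space_euclidean] W(2)
        by auto
      show "countable (range (\<lambda>n. closure (C n)))" by simp
      fix T assume "T \<in> range (\<lambda>n. closure (C n))"
      then obtain n where T: "T = closure (C n)" by blast
      have "closure (C n) \<subseteq> W" using CW W(2) by (rule closure_minimal)
      then have "closedin (top_of_set W) (closure (C n))" by (simp add: closed_subset)
      then show "closedin (top_of_set W) T \<and> top_of_set W interior_of T = {}"
        using no T by auto
    qed
    moreover have "W \<subseteq> (\<Union>n. closure (C n))"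
    proof
      fix w assume "w \<in> W"
      then obtain e where "e \<in> E" "w = A e" using AE by blast
      moreover obtain n :: nat where "norm e \<le> real n" using real_arch_simple by blast
      ultimately have "w \<in> C n" by (auto simp: C_def)
      then show "w \<in> (\<Union>n. closure (C n))" using closure_subset by blast
    qed
    then have "top_of_set W interior_of (\<Union>n. closure (C n)) = W"
      by (metis interior_of_mono interior_of_topspace subset_antisym interior_of_subset_topspace topspace_euclidean_subtopology)
    ultimately show False using subspace_0[OF W(1)] by blast
  qed
  then obtain n w0 where w0: "w0 \<in> top_of_set W interior_of closure (C n)" by blast
  then obtain V where V: "open V" "w0 \<in> V" "w0 \<in> W" "W \<inter> V \<subseteq> closure (C n)"
    by (auto simp: interior_of_def openin_open)
  then obtain d where d: "d > 0" "ball w0 d \<subseteq> V" using openE by blast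
  have near: "\<exists>e\<in>E. norm e \<le> 2 * real n \<and> norm (w - A e) < \<epsilon>"
    if w: "w \<in> W" "norm w < d" and \<epsilon>: "\<epsilon> > 0" for w \<epsilon>
  proof -
    have "w0 + w \<in> ball w0 d" "w0 \<in> ball w0 d" using w d by (auto simp: dist_norm)
    then have "w0 + w \<in> closure (C n)" "w0 \<in> closure (C n)"
      using V d subspace_add[OF W(1) V(3) w(1)] by blast+
    then obtain a b where a: "a \<in> E" "norm a \<le> real n" "dist (A a) (w0 + w) < \<epsilon> / 2"
      and b: "b \<in> E" "norm b \<le> real n" "dist (A b) w0 < \<epsilon> / 2"
      using \<epsilon> unfolding closure_approachable C_def by (fastforce dest: spec[of _ "\<epsilon> / 2"])
    have "norm (a - b) \<le> 2 * real n" using norm_triangle_ineq4[of a b] a b by linarith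
    moreover have "norm (w - A (a - b)) = norm ((w0 + w - A a) - (w0 - A b))" by (simp add: A.diff algebra_simps)
    then have "norm (w - A (a - b)) < \<epsilon>"
      using norm_triangle_ineq4[of "w0 + w - A a" "w0 - A b"] a(3) b(3)
      unfolding dist_norm norm_minus_commute[of "A a"] norm_minus_commute[of "A b"] by linarith
    ultimately show ?thesis using subspace_diff[OF E(1) a(1) b(1)] by blast
  qed
  \<comment> \<open>the summand \<open>1\<close> keeps \<open>K\<close> positive when \<open>n = 0\<close>\<close>
  define K where "K = 4 * real n / d + 1"
  have "\<exists>e\<in>E. norm e \<le> K * norm w \<and> norm (w - A e) \<le> norm w / 2" if w: "w \<in> W" for w
  proof (cases "w = 0")
    case True
    then show ?thesis using subspace_0[OF E(1)] by (intro bexI[of _ 0]) (auto simp: A.zero)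
  next
    case False
    \<comment> \<open>rescale \<open>w\<close> to norm \<open>d / 2\<close>, where preimages up to an error of \<open>d / 4\<close> are available\<close>
    define t where "t = d / (2 * norm w)"
    have t: "t > 0" "t * norm w = d / 2" using False d by (auto simp: t_def)
    have "t *\<^sub>R w \<in> W" "norm (t *\<^sub>R w) < d" using t d w W(1) by (auto intro: subspace_scale)
    then obtain e where e: "e \<in> E" "norm e \<le> 2 * real n" "norm (t *\<^sub>R w - A e) < d / 4"
      using near[of "t *\<^sub>R w" "d/4"] d by auto
    have "norm ((1/t) *\<^sub>R e) \<le> (1/t) * (2 * real n)" using e t by (simp add: divide_right_mono)
    also have "(1/t) * (2 * real n) = 4 * real n / d * norm w" using False d by (simp add: t_def)
    also have "\<dots> \<le> K * norm w" unfolding K_def by (rule mult_right_mono) auto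
    finally have 1: "norm ((1/t) *\<^sub>R e) \<le> K * norm w" .
    have "w - A ((1/t) *\<^sub>R e) = (1/t) *\<^sub>R (t *\<^sub>R w - A e)"
      using t by (simp add: A.scaleR scaleR_diff_right)
    then have "norm (w - A ((1/t) *\<^sub>R e)) = (1/t) * norm (t *\<^sub>R w - A e)" using t by simp
    also have "\<dots> \<le> (1/t) * (d / 4)" using e t by (intro mult_left_mono) auto
    also have "\<dots> = norm w / 2" using False d by (simp add: t_def)
    finally show ?thesis using 1 e(1) E(1) subspace_scale by blast
  qed
  then have "\<exists>e\<in>E. norm e \<le> 2 * K * norm w \<and> A e = w" if "w \<in> W" for w
    using approximate_preimage_imp_preimage[OF A E W(1), of K w] AE that by blast
  moreover have "2 * K > 0" using d by (simp add: K_def add_nonneg_pos)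
  ultimately show ?thesis by blast
qed

text \<open>A bounded preimage under \<open>A\<close> is an approximate preimage under every operator close to \<open>A\<close>
  on \<open>E\<close>.\<close>

lemma surjective_on_perturbation:
  fixes A :: "'a::banach \<Rightarrow> 'b::banach"
  assumes A: "bounded_linear A" and E: "subspace E" "closed E" and W: "subspace W" "closed W"
    and AE: "A ` E = W"
  shows "\<exists>r>0. \<forall>C. bounded_linear C \<longrightarrow> C ` E \<subseteq> W \<longrightarrow>
    (\<forall>e\<in>E. norm (A e - C e) \<le> r * norm e) \<longrightarrow> C ` E = W"
proof -
  obtain K where K: "K > 0" "\<forall>w\<in>W. \<exists>e\<in>E. norm e \<le> K * norm w \<and> A e = w"
    using open_mapping_on[OF assms] by auto
  have "C ` E = W" if C: "bounded_linear C" "C ` E \<subseteq> W" "\<forall>e\<in>E. norm (A e - C e) \<le> 1 / (2 * K) * norm e" for C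
  proof -
    have "\<exists>e\<in>E. norm e \<le> K * norm w \<and> norm (w - C e) \<le> norm w / 2" if w: "w \<in> W" for w
    proof -
      obtain e where e: "e \<in> E" "norm e \<le> K * norm w" "A e = w" using K(2) w by blast
      have "norm (w - C e) \<le> 1 / (2 * K) * norm e" using C(3) e by auto
      also have "\<dots> \<le> 1 / (2 * K) * (K * norm w)" using e K(1) by (intro mult_left_mono) auto
      finally show ?thesis using e K(1) by auto
    qed
    then have "\<exists>e\<in>E. norm e \<le> 2 * K * norm w \<and> C e = w" if "w \<in> W" for w
      using approximate_preimage_imp_preimage[OF C(1) E W(1) C(2)] that by blast
    then show ?thesis using C(2) by blast
  qed
  then show ?thesis using K(1) by (intro exI[of _ "1 / (2 * K)"]) simp
qed

section \<open>Complex subspaces and finite-dimensional extensions\<close>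

abbreviation "csubspace \<equiv> complex_vector.subspace"
abbreviation "cspan \<equiv> complex_vector.span"

lemma csubspace_imp_subspace: "csubspace E \<Longrightarrow> subspace E"
  by (auto simp: complex_vector.subspace_def subspace_def scaleR_scaleC)

lemma cspan_csubspace [simp]: "csubspace W \<Longrightarrow> cspan W = W"
  by (simp only: complex_vector.span_eq_iff)

lemma cspan_scale_cancel:
  assumes "k *\<^sub>C b \<in> cspan X" "b \<notin> cspan X"
  shows "k = 0"
proof (rule ccontr)
  assume "k \<noteq> 0"
  then have "inverse k *\<^sub>C k *\<^sub>C b = b" by (simp add: scaleC_scaleC scaleC_one)
  then show False using assms complex_vector.span_scale by metis
qed

lemma bounded_clinear_module_hom:
  "bounded_clinear S \<Longrightarrow> module_hom scaleC scaleC S"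
  unfolding bounded_clinear_def
  by unfold_locales (auto simp: scaleC_add_right scaleC_add_left scaleC_scaleC scaleC_one
      linear_simps)

lemma bounded_clinear_cspan_image: "bounded_clinear S \<Longrightarrow> cspan (S ` B) = S ` cspan B"
  by (rule module_hom.span_image[OF bounded_clinear_module_hom])

lemma bounded_clinear_csubspace_image: "bounded_clinear S \<Longrightarrow> csubspace B \<Longrightarrow> csubspace (S ` B)"
  by (rule module_hom.subspace_image[OF bounded_clinear_module_hom])

lemma bounded_clinear_funpow:
  fixes S :: "'a::complex_banach \<Rightarrow> 'a"
  shows "bounded_clinear S \<Longrightarrow> bounded_clinear (S ^^ n)"
proof (induction n)
  case 0
  show ?case using bounded_linear_ident by (simp add: bounded_clinear_def id_def)
next
  case (Suc n)
  have "S ^^ Suc n = (\<lambda>x. S ((S ^^ n) x))" by auto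
  then show ?case using Suc by (simp add: bounded_clinear_def bounded_linear_compose)
qed

lemma bounded_clinear_shift:
  fixes S :: "'a::complex_banach \<Rightarrow> 'a"
  assumes "bounded_clinear S"
  shows "bounded_clinear (\<lambda>x. S x - z *\<^sub>C x)"
proof -
  have "bounded_linear (\<lambda>x::'a. z *\<^sub>C x)"
    by (rule bounded_linear_intro[where K = "cmod z"])
      (auto simp: scaleC_add_right scaleR_scaleC scaleC_scaleC norm_scaleC mult.commute)
  then show ?thesis
    using assms unfolding bounded_clinear_def
    by (auto intro: bounded_linear_sub simp: complex_vector.scale_right_diff_distrib scaleC_scaleC mult.commute)
qed

lemma cspan_Un_subspace: "csubspace R \<Longrightarrow> cspan (R \<union> B) = {x + y |x y. x \<in> R \<and> y \<in> cspan B}"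
  by (simp add: complex_vector.span_Un)

text \<open>The coefficient of \<open>v\<close> is controlled by the distance of \<open>v\<close> to \<open>W\<close>. Both the closedness of
  finite-dimensional extensions and the continuity of coordinates rest on this estimate.\<close>

lemma closed_csubspace_add_line:
  fixes W :: "'a::complex_banach set"
  assumes W: "csubspace W" "closed W" and v: "v \<notin> W"
  shows "infdist v W > 0" and "w \<in> W \<Longrightarrow> cmod c * infdist v W \<le> norm (w + c *\<^sub>C v)"
proof -
  have ne: "W \<noteq> {}" using complex_vector.subspace_0[OF W(1)] by blast
  show "infdist v W > 0"
    using ne W(2) v in_closed_iff_infdist_zero infdist_nonneg by (metis order_less_le)
  show "cmod c * infdist v W \<le> norm (w + c *\<^sub>C v)" if w: "w \<in> W"
  proof (cases "c = 0")
    case False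
    have "(- inverse c) *\<^sub>C w \<in> W" using W(1) w by (rule complex_vector.subspace_scale)
    then have "infdist v W \<le> norm (v - (- inverse c) *\<^sub>C w)" by (metis infdist_le dist_norm)
    then have "cmod c * infdist v W \<le> norm (c *\<^sub>C (v - (- inverse c) *\<^sub>C w))"
      by (simp add: norm_scaleC mult_left_mono)
    also have "c *\<^sub>C (v - (- inverse c) *\<^sub>C w) = w + c *\<^sub>C v"
      using False by (simp add: complex_vector.scale_right_diff_distrib scaleC_add_right scaleC_scaleC scaleC_one)
    finally show ?thesis .
  qed simp
qed

text \<open>By the previous estimate, the coefficients of \<open>v\<close> along a convergent sequence form a Cauchy sequence.\<close>

lemma closed_cspan_insert:
  fixes W :: "'a::complex_banach set"
  assumes W: "csubspace W" "closed W"
  shows "closed (cspan (insert v W))"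
proof (cases "v \<in> W")
  case True
  then show ?thesis using W by (simp add: insert_absorb)
next
  case False
  note d = closed_csubspace_add_line[OF W False]
  have "l \<in> cspan (insert v W)" if x: "\<forall>n. x n \<in> cspan (insert v W)" "x \<longlonglongrightarrow> l" for x l
  proof -
    have "\<forall>n. \<exists>k. x n - k *\<^sub>C v \<in> W"
      using x(1) W(1) by (simp add: complex_vector.span_breakdown_eq)
    then obtain k where k: "\<And>n. x n - k n *\<^sub>C v \<in> W" by metis
    have est: "cmod (k m - k n) * infdist v W \<le> dist (x m) (x n)" for m n
    proof -
      have "(x m - k m *\<^sub>C v) - (x n - k n *\<^sub>C v) \<in> W" using k W(1) complex_vector.subspace_diff by blast
      from d(2)[OF this, of "k m - k n"] show ?thesis
        by (simp add: dist_norm complex_vector.scale_left_diff_distrib)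
    qed
    have "Cauchy k"
    proof (rule metric_CauchyI)
      fix e :: real assume "e > 0"
      then obtain M where M: "\<forall>m\<ge>M. \<forall>n\<ge>M. dist (x m) (x n) < e * infdist v W"
        using LIMSEQ_imp_Cauchy[OF x(2)] d(1) by (meson metric_CauchyD mult_pos_pos)
      then have "dist (k m) (k n) < e" if "m \<ge> M" "n \<ge> M" for m n
        using est[of m n] M that d(1) by (metis dist_norm mult_less_cancel_right_pos order_le_less_trans)
      then show "\<exists>M. \<forall>m\<ge>M. \<forall>n\<ge>M. dist (k m) (k n) < e" by blast
    qed
    then obtain c where c: "k \<longlonglongrightarrow> c" by (auto simp: Cauchy_convergent_iff convergent_def)
    have "(\<lambda>n. (k n - c) *\<^sub>C v) \<longlonglongrightarrow> 0"
    proof (rule Lim_null_comparison)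
      show "\<forall>\<^sub>F n in sequentially. norm ((k n - c) *\<^sub>C v) \<le> norm (k n - c) * norm v" by (simp add: norm_scaleC)
      have "(\<lambda>n. norm (k n - c)) \<longlonglongrightarrow> 0" using c by (simp add: LIM_zero tendsto_norm_zero)
      then show "(\<lambda>n. norm (k n - c) * norm v) \<longlonglongrightarrow> 0" by (rule tendsto_mult_left_zero)
    qed
    from tendsto_diff[OF x(2) this] have "(\<lambda>n. (x n - k n *\<^sub>C v) + c *\<^sub>C v) \<longlonglongrightarrow> l"
      by (simp add: complex_vector.scale_left_diff_distrib algebra_simps)
    from tendsto_diff[OF this tendsto_const[of "c *\<^sub>C v"]] have "(\<lambda>n. x n - k n *\<^sub>C v) \<longlonglongrightarrow> l - c *\<^sub>C v" by simp
    then have "l - c *\<^sub>C v \<in> W" by (rule closed_sequentially[OF W(2) k])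
    then show ?thesis using W(1) by (auto simp: complex_vector.span_breakdown_eq)
  qed
  then show ?thesis unfolding closed_sequential_limits by blast
qed

lemma closed_cspan_Un_finite:
  fixes W :: "'a::complex_banach set"
  assumes "csubspace W" "closed W" "finite B"
  shows "closed (cspan (W \<union> B))"
  using assms(3)
proof (induction B)
  case (insert b B)
  have "cspan (W \<union> insert b B) = cspan (insert b (cspan (W \<union> B)))"
    by (simp add: complex_vector.span_insert complex_vector.span_span)
  then show ?case using closed_cspan_insert[OF complex_vector.subspace_span insert.IH] by simp
qed (use assms in simp)

lemma closed_cspan_finite:
  fixes B :: "'a::complex_banach set"
  shows "finite B \<Longrightarrow> closed (cspan B)"
  using closed_cspan_Un_finite[of "{0}" B] by (simp add: complex_vector.subspace_single_0 complex_vector.span_insert_0)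

lemma finite_complement_in_span:
  fixes R :: "'a::complex_banach set"
  assumes "csubspace R" "finite B"
  shows "\<exists>B'\<subseteq>B. cspan (R \<union> B') = cspan (R \<union> B) \<and> cspan B' \<inter> R = {0}"
  using assms(2)
proof (induction B)
  case empty
  then show ?case using complex_vector.subspace_0[OF assms(1)] by auto
next
  case (insert b B)
  obtain B' where B': "B' \<subseteq> B" "cspan (R \<union> B') = cspan (R \<union> B)" "cspan B' \<inter> R = {0}" using insert.IH by metis
  show ?case
  proof (cases "b \<in> cspan (R \<union> B)")
    case True
    then show ?thesis using B' by (intro exI[of _ B']) (auto simp: complex_vector.span_redundant)
  next
    case False
    have "x = 0" if x: "x \<in> cspan (insert b B')" "x \<in> R" for x
    proof -
      obtain k where k: "x - k *\<^sub>C b \<in> cspan B'" using x by (auto simp: complex_vector.span_breakdown_eq)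
      then have "x - k *\<^sub>C b \<in> cspan (R \<union> B')" using complex_vector.span_mono[of B' "R \<union> B'"] by auto
      moreover have "x \<in> cspan (R \<union> B')" using x(2) by (simp add: complex_vector.span_base)
      ultimately have "k *\<^sub>C b \<in> cspan (R \<union> B')" using complex_vector.span_diff by fastforce
      then have "k = 0" using False B'(2) by (auto dest: cspan_scale_cancel)
      then show ?thesis using k B'(3) x(2) by auto
    qed
    moreover have "cspan (R \<union> insert b B') = cspan (R \<union> insert b B)"
      using B'(2) by (simp add: complex_vector.span_insert)
    ultimately show ?thesis using B'(1) complex_vector.subspace_0[OF assms(1)]
      by (intro exI[of _ "insert b B'"]) (auto simp: complex_vector.span_zero)
  qed
qed

section \<open>Ranges of finite codimension\<close>

lemma Inf_enat_less_infinity_iff: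
  fixes E :: "enat set"
  assumes "\<infinity> \<notin> E"
  shows "Inf E < \<infinity> \<longleftrightarrow> E \<noteq> {}"
proof
  assume "Inf E < \<infinity>"
  then show "E \<noteq> {}" by (auto simp: Inf_enat_def)
next
  assume "E \<noteq> {}"
  then obtain e where "e \<in> E" by blast
  then have "Inf E \<le> e" "e < \<infinity>" using assms by (cases e; auto intro: Inf_lower)+
  then show "Inf E < \<infinity>" by (rule order_le_less_trans)
qed

lemma lower_semi_Fredholm_on_iff:
  "lower_semi_Fredholm_on M S \<longleftrightarrow> (\<exists>B. finite B \<and> B \<subseteq> M \<and> cspan (S ` M \<union> B) = M)"
proof -
  from Inf_enat_less_infinity_iff[of "{enat (card B) |B. finite B \<and> B \<subseteq> M \<and> cspan (S ` M \<union> B) = M}"]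
  show ?thesis by (auto simp: lower_semi_Fredholm_on_def codim_in_def)
qed

text \<open>A range of finite codimension is handled through the surjection \<open>(x, y) \<mapsto> A x + y\<close>, defined on
  the product of \<open>E\<close> with the finite-dimensional span of \<open>B\<close>. The open mapping theorem and its
  perturbation form apply to this map.\<close>

lemma open_mapping_modulo_finite:
  fixes A :: "'a::complex_banach \<Rightarrow> 'b::complex_banach" and B :: "'b set"
  defines "D \<equiv> (\<lambda>p. A (fst p) + snd p)"
  assumes A: "bounded_clinear A" and E: "csubspace E" "closed E" and W: "csubspace W" "closed W"
    and B: "finite B" "cspan (A ` E \<union> B) = W"
  shows bounded_linear_add_snd: "bounded_linear D"
    and image_add_cspan: "D ` (E \<times> cspan B) = W"
    and subspace_Times_cspan: "subspace (E \<times> cspan B)" and closed_Times_cspan: "closed (E \<times> cspan B)"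
    and bounded_preimage_modulo_finite:
      "\<exists>K>0. \<forall>w\<in>W. \<exists>x\<in>E. \<exists>y\<in>cspan B. w = A x + y \<and> norm x \<le> K * norm w \<and> norm y \<le> K * norm w"
proof -
  interpret A: bounded_linear A using A by (simp add: bounded_clinear_def)
  show D: "bounded_linear D" unfolding D_def
    by (intro bounded_linear_add bounded_linear_compose[OF A.bounded_linear_axioms] bounded_linear_fst bounded_linear_snd)
  have W_eq: "W = {x + y |x y. x \<in> A ` E \<and> y \<in> cspan B}"
    using cspan_Un_subspace[OF bounded_clinear_csubspace_image[OF A E(1)], of B] B(2) by simp
  show DW: "D ` (E \<times> cspan B) = W"
  proof (intro set_eqI iffI)
    fix w assume "w \<in> D ` (E \<times> cspan B)"
    then obtain x y where "x \<in> E" "y \<in> cspan B" "w = A x + y" by (auto simp: D_def)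
    then show "w \<in> W" unfolding W_eq by blast
  next
    fix w assume "w \<in> W"
    then obtain x y where "x \<in> E" "y \<in> cspan B" "w = A x + y" unfolding W_eq by blast
    then show "w \<in> D ` (E \<times> cspan B)" by (intro image_eqI[of _ _ "(x, y)"]) (auto simp: D_def)
  qed
  show EF: "subspace (E \<times> cspan B)" "closed (E \<times> cspan B)"
    using E B(1) by (simp_all add: csubspace_imp_subspace subspace_Times closed_Times closed_cspan_finite)
  obtain K where K: "K > 0" "\<forall>w\<in>W. \<exists>e\<in>E \<times> cspan B. norm e \<le> K * norm w \<and> D e = w"
    using open_mapping_on[OF D EF csubspace_imp_subspace[OF W(1)] W(2) DW] by auto
  have "\<exists>x\<in>E. \<exists>y\<in>cspan B. w = A x + y \<and> norm x \<le> K * norm w \<and> norm y \<le> K * norm w" if w: "w \<in> W" for w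
  proof -
    obtain e where e: "e \<in> E \<times> cspan B" "norm e \<le> K * norm w" "D e = w" using K(2) w by blast
    have "norm (fst e) \<le> norm e" "norm (snd e) \<le> norm e"
      by (metis norm_fst_le prod.collapse) (metis norm_snd_le prod.collapse)
    then show ?thesis using e by (intro bexI[of _ "fst e"] bexI[of _ "snd e"]) (auto simp: D_def)
  qed
  then show "\<exists>K>0. \<forall>w\<in>W. \<exists>x\<in>E. \<exists>y\<in>cspan B. w = A x + y \<and> norm x \<le> K * norm w \<and> norm y \<le> K * norm w"
    using K(1) by blast
qed

text \<open>With a complementary span of \<open>B\<close>, the component \<open>y\<close> in \<open>w = A x + y\<close> is determined by \<open>w\<close>, and
  the open mapping theorem bounds it by a multiple of the norm of \<open>w\<close>. The range consists of the
  \<open>w\<close> with \<open>y = 0\<close>.\<close>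

lemma closed_range_finite_codim:
  fixes A :: "'a::complex_banach \<Rightarrow> 'b::complex_banach"
  assumes A: "bounded_clinear A" and E: "csubspace E" "closed E" and W: "csubspace W" "closed W"
    and B: "finite B" "cspan (A ` E \<union> B) = W"
  shows "closed (A ` E)"
proof -
  interpret A: bounded_linear A using A by (simp add: bounded_clinear_def)
  have AE: "csubspace (A ` E)" using bounded_clinear_csubspace_image[OF A E(1)] .
  obtain B' where B': "B' \<subseteq> B" "cspan (A ` E \<union> B') = W" "cspan B' \<inter> A ` E = {0}"
    using finite_complement_in_span[OF AE B(1)] B(2) by metis
  have fB': "finite B'" using finite_subset[OF B'(1) B(1)] .
  have W_eq: "W = {x + y |x y. x \<in> A ` E \<and> y \<in> cspan B'}"
    using cspan_Un_subspace[OF AE, of B'] B'(2) by simp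
  obtain K where K: "\<forall>w\<in>W. \<exists>x\<in>E. \<exists>y\<in>cspan B'. w = A x + y \<and> norm x \<le> K * norm w \<and> norm y \<le> K * norm w"
    using bounded_preimage_modulo_finite[OF A E W fB' B'(2)] by auto
  have AEW: "A ` E \<subseteq> W" using complex_vector.span_superset[of "A ` E \<union> B"] B(2) by auto
  have "l \<in> A ` E" if u: "\<forall>n. u n \<in> A ` E" "u \<longlonglongrightarrow> l" for u l
  proof -
    have uW: "u n \<in> W" for n using u(1) AEW by blast
    have "l \<in> W" by (rule closed_sequentially[OF W(2) uW u(2)])
    then obtain x y where xy: "x \<in> E" "y \<in> cspan B'" "l = A x + y" unfolding W_eq by blast
    have le: "norm y \<le> K * norm (u n - l)" for n
    proof -
      obtain x' where x': "x' \<in> E" "u n = A x'" using u(1)[rule_format, of n] by blast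
      have "u n - l \<in> W" by (rule complex_vector.subspace_diff[OF W(1) uW \<open>l \<in> W\<close>])
      then obtain v f where vf: "v \<in> E" "f \<in> cspan B'" "u n - l = A v + f" "norm f \<le> K * norm (u n - l)"
        using K by blast
      have "y + f = A (x' - x - v)"
        using vf(3) xy(3) x'(2) by (simp add: A.diff A.add algebra_simps)
      moreover have "x' - x - v \<in> E" using x' xy vf(1) E(1) by (intro complex_vector.subspace_diff) auto
      moreover have "y + f \<in> cspan B'" using xy(2) vf(2) by (rule complex_vector.span_add)
      ultimately have "y + f = 0" using B'(3) by blast
      then have "y = - f" by (simp add: eq_neg_iff_add_eq_0)
      then show ?thesis using vf(4) by simp
    qed
    have "(\<lambda>n. K * norm (u n - l)) \<longlonglongrightarrow> 0"
      using u(2) by (intro tendsto_mult_right_zero tendsto_norm_zero LIM_zero)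
    then have "norm y \<le> 0" using le by (intro LIMSEQ_le_const) auto
    then show ?thesis using xy by auto
  qed
  then show ?thesis unfolding closed_sequential_limits by blast
qed

section \<open>Stabilization of iterated ranges\<close>

lemma independent_mod_sum_zero:
  assumes Z: "csubspace Z" and B: "finite B"
    and ind: "\<And>b. b \<in> B \<Longrightarrow> g b \<notin> cspan (Z \<union> g ` (B - {b}))"
    and sum: "(\<Sum>b\<in>B. c b *\<^sub>C g b) \<in> Z" and b: "b \<in> B"
  shows "c b = 0"
proof (rule ccontr)
  assume c: "c b \<noteq> 0"
  let ?V = "cspan (Z \<union> g ` (B - {b}))"
  have "(\<Sum>b\<in>B. c b *\<^sub>C g b) = c b *\<^sub>C g b + (\<Sum>b\<in>B - {b}. c b *\<^sub>C g b)"
    by (rule sum.remove[OF B b])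
  moreover have "(\<Sum>b\<in>B - {b}. c b *\<^sub>C g b) \<in> ?V"
    by (intro complex_vector.span_sum complex_vector.span_scale complex_vector.span_base) auto
  moreover have "(\<Sum>b\<in>B. c b *\<^sub>C g b) \<in> ?V" using sum by (intro complex_vector.span_base) auto
  ultimately have "(c b *\<^sub>C g b + (\<Sum>b\<in>B - {b}. c b *\<^sub>C g b)) - (\<Sum>b\<in>B - {b}. c b *\<^sub>C g b) \<in> ?V"
    by (intro complex_vector.span_diff) simp_all
  then have "c b *\<^sub>C g b \<in> ?V" by simp
  then show False using cspan_scale_cancel[OF _ ind[OF b]] c by blast
qed

text \<open>The codimension of \<open>S\<^sup>n\<^sup>+\<^sup>1(M)\<close> in \<open>S\<^sup>n(M)\<close> does not increase with \<open>n\<close>, hence is constant from some \<open>m\<close> on.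
  To avoid dimensions, \<open>m\<close> and a spanning set \<open>B\<close> modulo \<open>S\<^sup>m\<^sup>+\<^sup>1(M)\<close> are chosen together with the
  least cardinality of \<open>B\<close>: as all images of \<open>B\<close> under powers of \<open>S\<close> span the corresponding
  quotients, none of their elements can be redundant.\<close>

lemma finite_codim_iterates_stabilize:
  assumes S: "bounded_clinear S"
    and B0: "finite B0" "cspan (S ` M \<union> B0) = M"
  obtains m B where "finite B" "cspan ((S ^^ Suc m) ` M \<union> B) = (S ^^ m) ` M"
    "\<And>k b. b \<in> B \<Longrightarrow> (S ^^ k) b \<notin> cspan ((S ^^ Suc (m + k)) ` M \<union> (S ^^ k) ` (B - {b}))"
proof -
  define P where "P n \<longleftrightarrow> (\<exists>m B. card B = n \<and> finite B \<and>
      cspan ((S ^^ Suc m) ` M \<union> B) = (S ^^ m) ` M)" for n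
  have "P (card B0)" unfolding P_def
    using B0 by (intro exI[of _ 0] exI[of _ B0]) simp
  then have PL: "P (LEAST n. P n)" by (rule LeastI)
  then obtain m B where mB: "card B = (LEAST n. P n)" "finite B"
      "cspan ((S ^^ Suc m) ` M \<union> B) = (S ^^ m) ` M" unfolding P_def by blast
  have "(S ^^ k) b \<notin> cspan ((S ^^ Suc (m + k)) ` M \<union> (S ^^ k) ` (B - {b}))" if b: "b \<in> B" for k b
  proof
    let ?C = "(S ^^ k) ` (B - {b})"
    assume dep: "(S ^^ k) b \<in> cspan ((S ^^ Suc (m + k)) ` M \<union> ?C)"
    have im: "(S ^^ k) ` ((S ^^ j) ` M) = (S ^^ (j + k)) ` M" for j
      by (simp add: image_comp funpow_add[symmetric] add.commute)
    have "(S ^^ (m + k)) ` M = (S ^^ k) ` cspan ((S ^^ Suc m) ` M \<union> B)" using mB(3) im by simp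
    also have "\<dots> = cspan ((S ^^ k) ` ((S ^^ Suc m) ` M \<union> B))"
      by (rule bounded_clinear_cspan_image[OF bounded_clinear_funpow[OF S], symmetric])
    also have "(S ^^ k) ` ((S ^^ Suc m) ` M \<union> B) = insert ((S ^^ k) b) ((S ^^ Suc (m + k)) ` M \<union> ?C)"
      using b im[of "Suc m"] unfolding image_Un by auto
    also have "cspan \<dots> = cspan ((S ^^ Suc (m + k)) ` M \<union> ?C)"
      by (rule complex_vector.span_redundant[OF dep])
    finally have eq: "cspan ((S ^^ Suc (m + k)) ` M \<union> ?C) = (S ^^ (m + k)) ` M" ..
    then have "P (card ?C)" unfolding P_def using mB(2) by blast
    then have "card B \<le> card ?C" using mB(1) Least_le by metis
    moreover have "card ?C \<le> card (B - {b})" using mB(2) by (intro card_image_le) auto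
    ultimately show False using card_Diff1_less[OF mB(2) b] by linarith
  qed
  then show thesis using that mB by blast
qed

text \<open>Here \<open>Y\<close> plays the role of \<open>S\<^sup>m(M)\<close> from the previous lemma, so that \<open>S\<close> on \<open>Y\<close> is semi-regular:
  its kernel lies in all ranges. If \<open>u = S\<^sup>n y\<close> with \<open>y = S w + f\<close> and \<open>S u = 0\<close>, then
  \<open>S\<^sup>n\<^sup>+\<^sup>1 f\<close> is in \<open>S\<^sup>n\<^sup>+\<^sup>2(Y)\<close>, and independence forces \<open>f = 0\<close>.\<close>

lemma kernel_subset_iterated_ranges:
  assumes S: "bounded_clinear S" and Y: "csubspace Y"
    and B: "finite B" "cspan (S ` Y \<union> B) = Y"
    and ind: "\<And>k b. b \<in> B \<Longrightarrow> (S ^^ k) b \<notin> cspan ((S ^^ Suc k) ` Y \<union> (S ^^ k) ` (B - {b}))"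
    and u: "u \<in> Y" "S u = 0"
  shows "u \<in> (S ^^ n) ` Y"
proof (induction n)
  case (Suc n)
  interpret Sn: module_hom scaleC scaleC "S ^^ Suc n"
    using bounded_clinear_module_hom[OF bounded_clinear_funpow[OF S]] .
  obtain y where y: "y \<in> Y" "u = (S ^^ n) y" using Suc by blast
  then obtain w f where w: "w \<in> Y" "f \<in> cspan B" "y = S w + f"
    using cspan_Un_subspace[OF bounded_clinear_csubspace_image[OF S Y], of B] B(2) by fastforce
  obtain c where c: "f = (\<Sum>b\<in>B. c b *\<^sub>C b)" using w(2) complex_vector.span_finite[OF B(1)] by auto
  have "0 = (S ^^ Suc n) y" using u(2) y(2) by simp
  also have "\<dots> = (S ^^ Suc n) (S w) + (\<Sum>b\<in>B. c b *\<^sub>C (S ^^ Suc n) b)"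
    unfolding w(3) c by (simp only: Sn.add Sn.sum Sn.scale)
  finally have "(\<Sum>b\<in>B. c b *\<^sub>C (S ^^ Suc n) b) = - (S ^^ Suc (Suc n)) w"
    by (simp add: eq_neg_iff_add_eq_0 funpow_swap1 add.commute)
  also have "\<dots> \<in> (S ^^ Suc (Suc n)) ` Y"
    by (rule complex_vector.subspace_neg[OF bounded_clinear_csubspace_image[OF bounded_clinear_funpow[OF S] Y] imageI[OF w(1)]])
  finally have sumZ: "(\<Sum>b\<in>B. c b *\<^sub>C (S ^^ Suc n) b) \<in> (S ^^ Suc (Suc n)) ` Y" .
  have "c b = 0" if "b \<in> B" for b
    by (rule independent_mod_sum_zero[OF bounded_clinear_csubspace_image[OF bounded_clinear_funpow[OF S] Y] B(1) _ sumZ that])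
      (rule ind)
  then have "f = 0" using c by simp
  then have "u = (S ^^ Suc n) w" using y w by (simp add: funpow_swap1)
  then show ?case using w(1) by blast
qed (use u in simp)

lemma finite_codim_funpow:
  assumes S: "bounded_clinear S" and M: "csubspace M" and B: "finite B" "cspan (S ` M \<union> B) = M"
  shows "\<exists>B'. finite B' \<and> cspan ((S ^^ n) ` M \<union> B') = M"
proof (induction n)
  case 0
  then show ?case using M by (intro exI[of _ "{}"]) simp
next
  case (Suc n)
  then obtain B' where B': "finite B'" "cspan ((S ^^ n) ` M \<union> B') = M" by auto
  have "(S ^^ n) ` M = (S ^^ n) ` cspan (S ` M \<union> B)" using B(2) by simp
  also have "\<dots> = cspan ((S ^^ n) ` (S ` M \<union> B))"
    by (rule bounded_clinear_cspan_image[OF bounded_clinear_funpow[OF S], symmetric])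
  also have "(S ^^ n) ` (S ` M \<union> B) = (S ^^ Suc n) ` M \<union> (S ^^ n) ` B"
    by (simp add: image_Un image_image funpow_swap1)
  finally have "cspan (cspan ((S ^^ Suc n) ` M \<union> (S ^^ n) ` B) \<union> B') = M" using B'(2) by simp
  moreover have "cspan (cspan X \<union> B') = cspan (X \<union> B')" for X
    by (simp add: complex_vector.span_Un complex_vector.span_span)
  ultimately have "cspan ((S ^^ Suc n) ` M \<union> ((S ^^ n) ` B \<union> B')) = M" by (simp add: Un_assoc)
  then show ?case using B(1) B'(1) by (intro exI[of _ "(S ^^ n) ` B \<union> B'"]) simp
qed

section \<open>Chains of functionals for infinite descent\<close>

lemma coordinate_functional:
  fixes W :: "'a::complex_banach set"
  assumes W: "csubspace W" "closed W" and v: "v \<notin> W"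
  obtains \<phi> :: "'a \<Rightarrow> complex" and C where
    "\<And>x y. x \<in> cspan (insert v W) \<Longrightarrow> y \<in> cspan (insert v W) \<Longrightarrow> \<phi> (x + y) = \<phi> x + \<phi> y"
    "\<And>c x. x \<in> cspan (insert v W) \<Longrightarrow> \<phi> (c *\<^sub>C x) = c * \<phi> x"
    "\<And>x. x \<in> cspan (insert v W) \<Longrightarrow> cmod (\<phi> x) \<le> C * norm x"
    "\<And>w. w \<in> W \<Longrightarrow> \<phi> w = 0" "\<phi> v = 1"
proof -
  let ?V = "cspan (insert v W)"
  note d = closed_csubspace_add_line[OF W v]
  define \<phi> where "\<phi> x = (SOME k. x - k *\<^sub>C v \<in> W)" for x
  have \<phi>: "x - \<phi> x *\<^sub>C v \<in> W" if "x \<in> ?V" for x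
    unfolding \<phi>_def by (rule someI_ex) (use that W(1) in \<open>simp add: complex_vector.span_breakdown_eq\<close>)
  have uniq: "\<phi> x = k" if x: "x \<in> ?V" and k: "x - k *\<^sub>C v \<in> W" for x k
  proof -
    have "(x - k *\<^sub>C v) - (x - \<phi> x *\<^sub>C v) \<in> W" by (rule complex_vector.subspace_diff[OF W(1) k \<phi>[OF x]])
    then have "(\<phi> x - k) *\<^sub>C v \<in> cspan W" using W(1) by (simp add: complex_vector.scale_left_diff_distrib)
    then have "\<phi> x - k = 0" by (rule cspan_scale_cancel) (use v W(1) in simp)
    then show ?thesis by simp
  qed
  show thesis
  proof
    fix x y assume xy: "x \<in> ?V" "y \<in> ?V"
    have "(x - \<phi> x *\<^sub>C v) + (y - \<phi> y *\<^sub>C v) \<in> W" using xy by (intro complex_vector.subspace_add W \<phi>)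
    then have "(x + y) - (\<phi> x + \<phi> y) *\<^sub>C v \<in> W" by (simp add: scaleC_add_left algebra_simps)
    then show "\<phi> (x + y) = \<phi> x + \<phi> y" using xy by (intro uniq complex_vector.span_add)
  next
    fix c x assume x: "x \<in> ?V"
    have "c *\<^sub>C (x - \<phi> x *\<^sub>C v) \<in> W" using x by (intro complex_vector.subspace_scale W \<phi>)
    then have "c *\<^sub>C x - (c * \<phi> x) *\<^sub>C v \<in> W" by (simp add: complex_vector.scale_right_diff_distrib scaleC_scaleC)
    then show "\<phi> (c *\<^sub>C x) = c * \<phi> x" using x by (intro uniq complex_vector.span_scale)
  next
    fix x assume x: "x \<in> ?V"
    have "cmod (\<phi> x) * infdist v W \<le> norm (x - \<phi> x *\<^sub>C v + \<phi> x *\<^sub>C v)" by (rule d(2)[OF \<phi>[OF x]])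
    then show "cmod (\<phi> x) \<le> (1 / infdist v W) * norm x" using d(1) by (simp add: field_simps)
  next
    fix w assume "w \<in> W"
    then show "\<phi> w = 0" by (intro uniq) (auto intro: complex_vector.span_base)
  next
    show "\<phi> v = 1" using W(1) by (intro uniq) (auto intro: complex_vector.span_base complex_vector.subspace_0 simp: scaleC_one)
  qed
qed

text \<open>When \<open>S(Y) \<noteq> Y\<close>, start from the coordinate functional \<open>\<phi>\<^sub>0\<close> of some \<open>b \<in> B\<close>, which vanishes on
  \<open>S(Y)\<close>, and solve \<open>\<phi>\<^sub>n\<^sub>+\<^sub>1 \<circ> S = \<phi>\<^sub>n\<close> repeatedly. The solution is \<open>\<phi>\<^sub>n \<circ> G\<close>, where \<open>G\<close> picks a
  preimage, of controlled norm, of the component in \<open>S(Y)\<close>. The map \<open>G\<close> is nonlinear in general, but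
  \<open>\<phi>\<^sub>n \<circ> G\<close> is linear, because two choices of preimage differ by a kernel element \<open>S\<^sup>n\<^sup>+\<^sup>1 w\<close>, and \<open>\<phi>\<^sub>n\<close> vanishes
  there.\<close>

lemma functional_chain:
  fixes S :: "'a::complex_banach \<Rightarrow> 'a"
  assumes S: "bounded_clinear S" and Y: "csubspace Y" "closed Y" "S ` Y \<subseteq> Y"
    and B: "finite B" "cspan (S ` Y \<union> B) = Y" "B \<noteq> {}"
    and ind: "\<And>k b. b \<in> B \<Longrightarrow> (S ^^ k) b \<notin> cspan ((S ^^ Suc k) ` Y \<union> (S ^^ k) ` (B - {b}))"
  obtains \<phi> :: "nat \<Rightarrow> 'a \<Rightarrow> complex" and C K where "K > 0"
    "\<And>n x y. x \<in> Y \<Longrightarrow> y \<in> Y \<Longrightarrow> \<phi> n (x + y) = \<phi> n x + \<phi> n y"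
    "\<And>n c x. x \<in> Y \<Longrightarrow> \<phi> n (c *\<^sub>C x) = c * \<phi> n x"
    "\<And>n x. x \<in> Y \<Longrightarrow> cmod (\<phi> n x) \<le> C * K ^ n * norm x"
    "\<And>x. x \<in> Y \<Longrightarrow> \<phi> 0 (S x) = 0" "\<And>n x. x \<in> Y \<Longrightarrow> \<phi> (Suc n) (S x) = \<phi> n x"
    "\<exists>y\<in>Y. \<phi> 0 y \<noteq> 0"
proof -
  interpret S: module_hom scaleC scaleC S using bounded_clinear_module_hom[OF S] .
  have SY: "csubspace (S ` Y)" by (rule bounded_clinear_csubspace_image[OF S Y(1)])
  have BY: "B \<subseteq> Y" using complex_vector.span_superset[of "S ` Y \<union> B"] B(2) by auto
  have SYc: "closed (S ` Y)" by (rule closed_range_finite_codim[OF S Y(1,2) Y(1,2) B(1,2)])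
  \<comment> \<open>the case \<open>k = 0\<close> of \<open>ind\<close>: the sum of \<open>S ` Y\<close> and the span of \<open>B\<close> is direct\<close>
  have cap: "x = 0" if x: "x \<in> cspan B" "x \<in> S ` Y" for x
  proof -
    obtain c where c: "x = (\<Sum>b\<in>B. c b *\<^sub>C b)" using x(1) complex_vector.span_finite[OF B(1)] by auto
    have "c b = 0" if "b \<in> B" for b
      by (rule independent_mod_sum_zero[OF SY B(1), of "\<lambda>x. x"]) (use ind[of _ 0] that x(2) c in auto)
    then show ?thesis by (simp add: c)
  qed
  obtain b where b: "b \<in> B" using B(3) by blast
  define W where "W = cspan (S ` Y \<union> (B - {b}))"
  have W: "csubspace W" "closed W" "b \<notin> W"
    using closed_cspan_Un_finite[OF SY SYc, of "B - {b}"] B(1) ind[OF b, of 0] by (simp_all add: W_def)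
  have SYW: "S ` Y \<subseteq> W" unfolding W_def using complex_vector.span_superset[of "S ` Y \<union> (B - {b})"] by auto
  have "cspan (insert b W) = cspan (insert b (S ` Y \<union> (B - {b})))"
    unfolding W_def by (simp add: complex_vector.span_insert complex_vector.span_span)
  also have "insert b (S ` Y \<union> (B - {b})) = S ` Y \<union> B" using b by blast
  finally have V: "cspan (insert b W) = Y" using B(2) by simp
  obtain \<phi>0 C where \<phi>0:
    "\<And>x y. x \<in> Y \<Longrightarrow> y \<in> Y \<Longrightarrow> \<phi>0 (x + y) = \<phi>0 x + \<phi>0 y"
    "\<And>c x. x \<in> Y \<Longrightarrow> \<phi>0 (c *\<^sub>C x) = c * \<phi>0 x"
    "\<And>x. x \<in> Y \<Longrightarrow> cmod (\<phi>0 x) \<le> C * norm x"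
    "\<And>w. w \<in> W \<Longrightarrow> \<phi>0 w = 0" "\<phi>0 b = 1"
    by (rule coordinate_functional[OF W, unfolded V]) rule
  obtain K where K: "K > 0" "\<forall>w\<in>Y. \<exists>x\<in>Y. \<exists>y\<in>cspan B. w = S x + y \<and> norm x \<le> K * norm w \<and> norm y \<le> K * norm w"
    using bounded_preimage_modulo_finite[OF S Y(1,2) Y(1,2) B(1,2)] by auto
  then obtain G where G: "\<And>y. y \<in> Y \<Longrightarrow> G y \<in> Y \<and> y - S (G y) \<in> cspan B \<and> norm (G y) \<le> K * norm y"
    by (metis add_diff_cancel_left')
  have GB: "y - S (G y) \<in> cspan B" if "y \<in> Y" for y using G[OF that] by blast
  define \<phi> where "\<phi> = rec_nat \<phi>0 (\<lambda>_ \<psi> y. \<psi> (G y))"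
  have \<phi>_0: "\<phi> 0 = \<phi>0" and \<phi>_Suc: "\<phi> (Suc n) = (\<lambda>y. \<phi> n (G y))" for n
    by (simp_all add: \<phi>_def)
  have C0: "0 \<le> C * norm b" using \<phi>0(3)[of b] BY b norm_ge_zero order_trans by blast
  have bn: "norm b > 0" using \<phi>0(4,5) complex_vector.subspace_0[OF W(1)] by force
  have C: "0 \<le> C" using C0 bn by (simp add: zero_le_mult_iff)
  have ker: "u \<in> (S ^^ n) ` Y" if "u \<in> Y" "S u = 0" for u n
    by (rule kernel_subset_iterated_ranges[OF S Y(1) B(1,2) _ that]) (rule ind)
  have main: "(\<forall>x\<in>Y. \<forall>y\<in>Y. \<phi> n (x + y) = \<phi> n x + \<phi> n y) \<and> (\<forall>c. \<forall>x\<in>Y. \<phi> n (c *\<^sub>C x) = c * \<phi> n x) \<and>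
     (\<forall>x\<in>Y. cmod (\<phi> n x) \<le> C * K ^ n * norm x) \<and> (\<forall>w\<in>Y. \<phi> n ((S ^^ Suc n) w) = 0) \<and>
     (\<forall>x\<in>Y. \<phi> (Suc n) (S x) = \<phi> n x)" for n
  proof -
    \<comment> \<open>if \<open>S x - S y\<close> is in the span of \<open>B\<close>, then \<open>x - y\<close> is in the kernel, hence in \<open>(S ^^ Suc n) ` Y\<close>\<close>
    have eqmod: "\<phi> n x = \<phi> n y" if x: "x \<in> Y" and y: "y \<in> Y" and Sxy: "S x - S y \<in> cspan B"
      and add: "\<forall>x\<in>Y. \<forall>y\<in>Y. \<phi> n (x + y) = \<phi> n x + \<phi> n y"
      and van: "\<forall>w\<in>Y. \<phi> n ((S ^^ Suc n) w) = 0" for n x y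
    proof -
      have xy: "x - y \<in> Y" by (rule complex_vector.subspace_diff[OF Y(1) x y])
      have "S (x - y) \<in> cspan B" using Sxy by (simp add: S.diff)
      then have "S (x - y) = 0" by (rule cap) (use xy in blast)
      then obtain w where "w \<in> Y" "x - y = (S ^^ Suc n) w" using ker[OF xy] by blast
      then have "\<phi> n (x - y) = 0" using van by metis
      moreover have "\<phi> n ((x - y) + y) = \<phi> n (x - y) + \<phi> n y" using add xy y by blast
      ultimately show ?thesis by simp
    qed
    have stepS: "\<phi> (Suc n) (S x) = \<phi> n x" if x: "x \<in> Y"
      and add: "\<forall>x\<in>Y. \<forall>y\<in>Y. \<phi> n (x + y) = \<phi> n x + \<phi> n y"
      and van: "\<forall>w\<in>Y. \<phi> n ((S ^^ Suc n) w) = 0" for n x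
    proof -
      have Sx: "S x \<in> Y" using Y(3) x by blast
      have "S (G (S x)) - S x = - (S x - S (G (S x)))" by simp
      also have "\<dots> \<in> cspan B" using G[OF Sx] by (intro complex_vector.span_neg) simp
      finally have "\<phi> n (G (S x)) = \<phi> n x" using G[OF Sx] x add van by (intro eqmod) auto
      then show ?thesis by (simp add: \<phi>_Suc)
    qed
    show ?thesis
    proof (induction n)
      case 0
      have v0: "\<forall>w\<in>Y. \<phi> 0 ((S ^^ Suc 0) w) = 0" using \<phi>0(4) SYW by (auto simp: \<phi>_0)
      then show ?case using stepS[of _ 0] \<phi>0 by (simp add: \<phi>_0)
    next
      case (Suc n)
      then have add: "\<forall>x\<in>Y. \<forall>y\<in>Y. \<phi> n (x + y) = \<phi> n x + \<phi> n y"
        and sc: "\<forall>c. \<forall>x\<in>Y. \<phi> n (c *\<^sub>C x) = c * \<phi> n x"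
        and bd: "\<forall>x\<in>Y. cmod (\<phi> n x) \<le> C * K ^ n * norm x"
        and van: "\<forall>w\<in>Y. \<phi> n ((S ^^ Suc n) w) = 0"
        and st: "\<forall>x\<in>Y. \<phi> (Suc n) (S x) = \<phi> n x" by blast+
      have 1: "\<phi> (Suc n) (x + y) = \<phi> (Suc n) x + \<phi> (Suc n) y" if x: "x \<in> Y" and y: "y \<in> Y" for x y
      proof -
        have xy: "x + y \<in> Y" by (rule complex_vector.subspace_add[OF Y(1) x y])
        have Gxy: "G x + G y \<in> Y" using G[OF x] G[OF y] by (intro complex_vector.subspace_add[OF Y(1)]) auto
        have "(x - S (G x)) + (y - S (G y)) - ((x + y) - S (G (x + y))) \<in> cspan B"
          by (rule complex_vector.span_diff[OF complex_vector.span_add[OF GB[OF x] GB[OF y]] GB[OF xy]])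
        then have "S (G (x + y)) - S (G x + G y) \<in> cspan B" by (simp add: S.add algebra_simps)
        then have "\<phi> n (G (x + y)) = \<phi> n (G x + G y)" using G[OF xy] Gxy add van by (intro eqmod) auto
        then show ?thesis using add G[OF x] G[OF y] by (simp add: \<phi>_Suc)
      qed
      have 2: "\<phi> (Suc n) (c *\<^sub>C x) = c * \<phi> (Suc n) x" if x: "x \<in> Y" for c x
      proof -
        have cx: "c *\<^sub>C x \<in> Y" by (rule complex_vector.subspace_scale[OF Y(1) x])
        have cG: "c *\<^sub>C G x \<in> Y" using G[OF x] by (intro complex_vector.subspace_scale[OF Y(1)]) auto
        have "c *\<^sub>C (x - S (G x)) - (c *\<^sub>C x - S (G (c *\<^sub>C x))) \<in> cspan B"
          by (rule complex_vector.span_diff[OF complex_vector.span_scale[OF GB[OF x]] GB[OF cx]])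
        then have "S (G (c *\<^sub>C x)) - S (c *\<^sub>C G x) \<in> cspan B"
          by (simp add: S.scale complex_vector.scale_right_diff_distrib algebra_simps)
        then have "\<phi> n (G (c *\<^sub>C x)) = \<phi> n (c *\<^sub>C G x)" using G[OF cx] cG add van by (intro eqmod) auto
        then show ?thesis using sc G[OF x] by (simp add: \<phi>_Suc)
      qed
      have 3: "cmod (\<phi> (Suc n) x) \<le> C * K ^ Suc n * norm x" if x: "x \<in> Y" for x
      proof -
        have "cmod (\<phi> (Suc n) x) \<le> C * K ^ n * norm (G x)" using bd G[OF x] by (simp add: \<phi>_Suc)
        also have "\<dots> \<le> C * K ^ n * (K * norm x)" using G[OF x] C K(1) by (intro mult_left_mono) auto
        finally show ?thesis by (simp add: mult_ac)
      qed
      have 4: "\<phi> (Suc n) ((S ^^ Suc (Suc n)) w) = 0" if w: "w \<in> Y" for w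
      proof -
        have "(S ^^ j) w \<in> Y" for j by (induction j) (use w Y(3) in auto)
        from this[of "Suc n"] have "\<phi> (Suc n) (S ((S ^^ Suc n) w)) = \<phi> n ((S ^^ Suc n) w)" using st by blast
        then show ?thesis using van w by simp
      qed
      show ?case using 1 2 3 4 stepS[of _ "Suc n"] by blast
    qed
  qed
  show thesis
  proof (rule that[of K \<phi> C])
    show "\<exists>y\<in>Y. \<phi> 0 y \<noteq> 0" using \<phi>0(5) b BY by (intro bexI[of _ b]) (auto simp: \<phi>_0)
    show "\<phi> 0 (S x) = 0" if "x \<in> Y" for x using \<phi>0(4) SYW that by (auto simp: \<phi>_0)
  qed (use main K(1) in blast)+
qed

section \<open>Infinite descent and failure of the single valued extension property\<close>

lemma bounded_linear_scaleC_left: "bounded_linear (\<lambda>c. c *\<^sub>C (a::'a::complex_banach))"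
  by (rule bounded_linear_intro[where K = "norm a"])
    (simp_all add: scaleC_add_left scaleR_scaleC scaleC_scaleC norm_scaleC scaleC_complex_def)

text \<open>Term by term differentiation; the radius \<open>1 / (4 K)\<close> leaves room for the factor \<open>n\<close>, which is
  estimated by \<open>2\<^sup>n\<close>.\<close>

lemma power_series_banach_analytic:
  fixes a :: "nat \<Rightarrow> 'a::complex_banach"
  assumes K: "K > 0" and a: "\<And>n. norm (a n) \<le> C * K ^ n"
  obtains f r where "r > 0" "\<And>z. z \<in> ball \<mu> r \<Longrightarrow> (\<lambda>n. (z - \<mu>) ^ n *\<^sub>C a n) sums f z"
    "banach_analytic_on f (ball \<mu> r)"
proof -
  define r where "r = 1 / (4 * K)"
  have r: "r > 0" using K by (simp add: r_def)
  have C: "C \<ge> 0" using order_trans[OF norm_ge_zero a[of 0]] by simp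
  define d where "d n z = (of_nat n * (z - \<mu>) ^ (n - 1)) *\<^sub>C a n" for n and z :: complex
  have d_le: "norm (d n z) \<le> 4 * C * K * (1/2) ^ n" if z: "z \<in> ball \<mu> r" for n z
  proof (cases n)
    case (Suc m)
    have "cmod (z - \<mu>) \<le> r" using z by (simp add: dist_norm norm_minus_commute)
    then have zr: "cmod (z - \<mu>) ^ m \<le> r ^ m" by (intro power_mono) auto
    have "norm (d n z) = real n * cmod (z - \<mu>) ^ m * norm (a n)"
      by (simp add: d_def Suc norm_scaleC norm_mult norm_power del: of_nat_Suc)
    also have "\<dots> \<le> 2 ^ n * r ^ m * (C * K ^ n)"
      using zr a[of n] r of_nat_less_two_power[of n, where 'a = real] by (intro mult_mono) auto
    also have "\<dots> = 2 * C * K * (2 * r * K) ^ m" by (simp add: Suc power_mult_distrib)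
    also have "2 * r * K = 1/2" using K by (simp add: r_def)
    also have "2 * C * K * (1/2) ^ m = 4 * C * K * (1/2) ^ n" by (simp add: Suc)
    finally show ?thesis .
  qed (use C K in \<open>simp add: d_def\<close>)
  have geo: "summable (\<lambda>n. 4 * C * K * (1/2::real) ^ n)" by (intro summable_mult summable_geometric) simp
  define D where "D z = (\<Sum>n. d n z)" for z
  have unif: "uniform_limit (ball \<mu> r) (\<lambda>n z. \<Sum>i<n. d i z) D sequentially"
    unfolding D_def by (rule Weierstrass_m_test[OF d_le geo])
  have "\<exists>f. \<forall>z\<in>ball \<mu> r. (\<lambda>n. (z - \<mu>) ^ n *\<^sub>C a n) sums f z \<and>
      (f has_derivative (\<lambda>h. h *\<^sub>C D z)) (at z within ball \<mu> r)"
  proof (rule has_derivative_series[where f' = "\<lambda>n z h. h *\<^sub>C d n z" and x = \<mu> and l = "a 0"])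
    show "((\<lambda>z. (z - \<mu>) ^ n *\<^sub>C a n) has_derivative (\<lambda>h. h *\<^sub>C d n z)) (at z within ball \<mu> r)"
      for n z
    proof -
      have "((\<lambda>z. (z - \<mu>) ^ n) has_field_derivative of_nat n * (z - \<mu>) ^ (n - 1)) (at z within ball \<mu> r)"
        by (auto intro!: derivative_eq_intros)
      then have "((\<lambda>z. (z - \<mu>) ^ n) has_derivative (\<lambda>h. (of_nat n * (z - \<mu>) ^ (n - 1)) * h)) (at z within ball \<mu> r)"
        by (simp add: has_field_derivative_def)
      from bounded_linear.has_derivative[OF bounded_linear_scaleC_left this]
      show ?thesis by (simp add: d_def scaleC_scaleC mult_ac)
    qed
    show "\<forall>\<^sub>F n in sequentially. \<forall>z\<in>ball \<mu> r. \<forall>h. norm ((\<Sum>i<n. h *\<^sub>C d i z) - h *\<^sub>C D z) \<le> e * norm h"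
      if "e > 0" for e
    proof -
      have "\<forall>\<^sub>F n in sequentially. \<forall>z\<in>ball \<mu> r. dist (\<Sum>i<n. d i z) (D z) < e"
        using unif that by (simp add: uniform_limit_iff)
      then show ?thesis
      proof eventually_elim
        case (elim n)
        show ?case
        proof (intro ballI allI)
          fix z h assume "z \<in> ball \<mu> r"
          then have "norm ((\<Sum>i<n. d i z) - D z) \<le> e" using elim by (auto simp: dist_norm less_imp_le)
          then have "cmod h * norm ((\<Sum>i<n. d i z) - D z) \<le> e * cmod h"
            using mult_left_mono[of _ e "cmod h"] by (subst mult.commute[of e]) simp
          then show "norm ((\<Sum>i<n. h *\<^sub>C d i z) - h *\<^sub>C D z) \<le> e * norm h"
            by (simp add: complex_vector.scale_sum_right[symmetric] complex_vector.scale_right_diff_distrib[symmetric] norm_scaleC)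
        qed
      qed
    qed
    have "(\<lambda>n. (\<mu> - \<mu>) ^ n *\<^sub>C a n) = (\<lambda>n. if n = 0 then a n else 0)" by (auto simp: scaleC_one)
    then show "(\<lambda>n. (\<mu> - \<mu>) ^ n *\<^sub>C a n) sums a 0" using sums_single[of 0 a] by simp
  qed (use r in auto)
  then obtain f where f: "\<And>z. z \<in> ball \<mu> r \<Longrightarrow> (\<lambda>n. (z - \<mu>) ^ n *\<^sub>C a n) sums f z"
    "\<And>z. z \<in> ball \<mu> r \<Longrightarrow> (f has_derivative (\<lambda>h. h *\<^sub>C D z)) (at z within ball \<mu> r)" by blast
  have "banach_analytic_on f (ball \<mu> r)"
    unfolding banach_analytic_on_def using f(2) at_within_open[OF _ open_ball] by metis
  then show thesis using that r f(1) by blast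
qed

lemma cdual_apply_0 [simp]: "cdual_apply 0 x = 0"
  by transfer simp

lemma cdual_apply_diff: "cdual_apply (f - g) x = cdual_apply f x - cdual_apply g x"
  by transfer (simp add: minus_blinfun.rep_eq)

lemma cdual_apply_diff_right: "cdual_apply f (x - y) = cdual_apply f x - cdual_apply f y"
  using bounded_clinear_cdual_apply[of f] by (simp add: bounded_clinear_def linear_simps)

lemma cdual_apply_scaleC_right: "cdual_apply f (c *\<^sub>C x) = c * cdual_apply f x"
  using bounded_clinear_cdual_apply[of f] by (simp add: bounded_clinear_def scaleC_complex_def)

lemma norm_cdual_apply_le: "cmod (cdual_apply f x) \<le> norm f * norm x"
  by transfer (rule norm_blinfun)

lemma bounded_linear_cdual_apply_left: "bounded_linear (\<lambda>f. cdual_apply f x)"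
  by (rule bounded_linear_intro[where K = "norm x"])
    (simp_all add: cdual_apply_add scaleR_scaleC cdual_apply_scaleC norm_cdual_apply_le scaleC_complex_def)

lemma cdual_of_functional:
  fixes g :: "'a::complex_banach \<Rightarrow> complex"
  assumes "\<And>x y. g (x + y) = g x + g y" "\<And>c x. g (c *\<^sub>C x) = c * g x" "\<And>x. cmod (g x) \<le> L * norm x"
    and "0 \<le> L"
  obtains f where "cdual_apply f = g" "norm f \<le> L"
proof -
  have g: "bounded_linear g"
    by (rule bounded_linear_intro[where K = L])
      (use assms in \<open>simp_all add: scaleR_scaleC scaleC_complex_def mult.commute\<close>)
  then have bc: "bounded_clinear g" using assms(2) by (simp add: bounded_clinear_def scaleC_complex_def)
  define f where "f = cdual_of_blinfun (Blinfun g)"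
  have f: "cdual_apply f = g"
    using g bc by (simp add: f_def cdual_apply.rep_eq cdual_of_blinfun_inverse bounded_linear_Blinfun_apply)
  have "norm f \<le> L" unfolding norm_cdual_onorm f by (rule onorm_bound) (fact assms)+
  with f show thesis by (rule that)
qed

text \<open>The function \<open>f(z) = \<Sum>n. (z - \<mu>)\<^sup>n \<psi>\<^sub>n\<close> is analytic near \<open>\<mu>\<close>, takes the nonzero value \<open>\<psi>\<^sub>0\<close> at \<open>\<mu>\<close>,
  and the chain condition says exactly that it is an eigenvector function of the adjoint.\<close>

lemma not_SVEP_if_functional_chain:
  fixes T :: "'a::complex_banach \<Rightarrow> 'a"
  assumes T: "bounded_clinear T" and K: "K > 0" and bd: "\<And>n. norm (\<psi> n) \<le> C * K ^ n"
    and 0: "\<And>x. cdual_apply (\<psi> 0) (T x - \<mu> *\<^sub>C x) = 0"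
    and Suc: "\<And>n x. cdual_apply (\<psi> (Suc n)) (T x - \<mu> *\<^sub>C x) = cdual_apply (\<psi> n) x"
    and nz: "\<psi> 0 \<noteq> 0"
  shows "\<not> has_SVEP_at (cadjoint T) \<mu>"
proof
  assume svep: "has_SVEP_at (cadjoint T) \<mu>"
  obtain f r where r: "r > 0" and f: "\<And>z. z \<in> ball \<mu> r \<Longrightarrow> (\<lambda>n. (z - \<mu>) ^ n *\<^sub>C \<psi> n) sums f z"
    and an: "banach_analytic_on f (ball \<mu> r)"
    using power_series_banach_analytic[OF K bd] by blast
  have "cadjoint T (f z) - z *\<^sub>C f z = 0" if z: "z \<in> ball \<mu> r" for z
  proof (rule cdual_eqI)
    fix x
    let ?S = "T x - \<mu> *\<^sub>C x"
    have s: "(\<lambda>n. (z - \<mu>) ^ n * cdual_apply (\<psi> n) y) sums cdual_apply (f z) y" for y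
      using bounded_linear.sums[OF bounded_linear_cdual_apply_left f[OF z], of y] by (simp add: cdual_apply_scaleC)
    have "(\<lambda>n. (z - \<mu>) ^ Suc n * cdual_apply (\<psi> (Suc n)) ?S) sums cdual_apply (f z) ?S"
      using s[of ?S] sums_Suc_iff[of "\<lambda>n. (z - \<mu>) ^ n * cdual_apply (\<psi> n) ?S"] 0 by simp
    then have "(\<lambda>n. (z - \<mu>) * ((z - \<mu>) ^ n * cdual_apply (\<psi> n) x)) sums cdual_apply (f z) ?S"
      by (simp add: Suc mult.assoc)
    moreover have "(\<lambda>n. (z - \<mu>) * ((z - \<mu>) ^ n * cdual_apply (\<psi> n) x)) sums ((z - \<mu>) * cdual_apply (f z) x)"
      using s by (rule sums_mult)
    ultimately have "cdual_apply (f z) ?S = (z - \<mu>) * cdual_apply (f z) x" by (rule sums_unique2)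
    then show "cdual_apply (cadjoint T (f z) - z *\<^sub>C f z) x = cdual_apply 0 x"
      by (simp add: cdual_apply_diff cdual_apply_diff_right cdual_apply_scaleC cdual_apply_scaleC_right
          cdual_apply_cadjoint[OF T] algebra_simps)
  qed
  then have "f \<mu> = 0"
    using svep[unfolded has_SVEP_at_def, rule_format, of "ball \<mu> r" f \<mu>] r an by simp
  moreover have "f \<mu> = \<psi> 0"
  proof -
    have "(\<lambda>n. (\<mu> - \<mu>) ^ n *\<^sub>C \<psi> n) = (\<lambda>n. if n = 0 then \<psi> n else 0)" by (auto simp: scaleC_one)
    then have "(\<lambda>n. (\<mu> - \<mu>) ^ n *\<^sub>C \<psi> n) sums \<psi> 0" using sums_single[of 0 \<psi>] by simp
    then show ?thesis using f[of \<mu>] r sums_unique2 by fastforce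
  qed
  ultimately show False using nz by simp
qed

text \<open>The projection onto \<open>M\<close> along \<open>N\<close> is bounded by the open mapping theorem for addition.\<close>

lemma Red_projection:
  assumes "(M, N) \<in> Red S"
  obtains p and L :: real where "L > 0" "\<And>x. p x \<in> M" "\<And>x. x - p x \<in> N" "\<And>x. norm (p x) \<le> L * norm x"
    "\<And>x y. p (x + y) = p x + p y" "\<And>c x. p (c *\<^sub>C x) = c *\<^sub>C p x"
    "\<And>x. x \<in> M \<Longrightarrow> p x = x" 
proof -
  have M: "csubspace M" "closed M" and N: "csubspace N" "closed N" and MN: "M \<inter> N = {0}"
    and sum: "{x + y |x y. x \<in> M \<and> y \<in> N} = UNIV" using assms by (auto simp: Red_def)
  let ?A = "\<lambda>u::'a \<times> 'a. fst u + snd u"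
  have A: "bounded_linear ?A" by (intro bounded_linear_add bounded_linear_fst bounded_linear_snd)
  have im: "?A ` (M \<times> N) = UNIV"
  proof (rule UNIV_eq_I[symmetric])
    fix x
    have "x \<in> {x + y |x y. x \<in> M \<and> y \<in> N}" using sum by simp
    then obtain a b where "a \<in> M" "b \<in> N" "x = a + b" by blast
    then show "x \<in> ?A ` (M \<times> N)" by (intro image_eqI[of _ _ "(a, b)"]) auto
  qed
  have EF: "subspace (M \<times> N)" "closed (M \<times> N)"
    using M N by (simp_all add: csubspace_imp_subspace subspace_Times closed_Times)
  obtain L where L: "L > 0" "\<forall>w\<in>UNIV. \<exists>e\<in>M \<times> N. norm e \<le> L * norm w \<and> ?A e = w"
    using open_mapping_on[OF A EF subspace_UNIV closed_UNIV im] by auto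
  have "\<exists>m. m \<in> M \<and> x - m \<in> N \<and> norm m \<le> L * norm x" for x
  proof -
    obtain e where e: "e \<in> M \<times> N" "norm e \<le> L * norm x" "?A e = x" using L(2) by blast
    have "norm (fst e) \<le> norm e" by (metis norm_fst_le prod.collapse)
    then show ?thesis using e by (intro exI[of _ "fst e"]) auto
  qed
  then obtain p where p: "\<And>x. p x \<in> M \<and> x - p x \<in> N \<and> norm (p x) \<le> L * norm x" by metis
  have uniq: "p x = m" if "m \<in> M" "x - m \<in> N" for x m
  proof -
    have "p x - m \<in> M" using p that(1) by (blast intro: complex_vector.subspace_diff[OF M(1)])
    moreover have "(x - m) - (x - p x) \<in> N" using p that(2) by (blast intro: complex_vector.subspace_diff[OF N(1)])
    then have "p x - m \<in> N" by simp
    ultimately have "p x - m = 0" using MN by blast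
    then show ?thesis by simp
  qed
  show thesis
  proof (rule that[of L p])
    show "p (x + y) = p x + p y" for x y
    proof (rule uniq)
      show "p x + p y \<in> M" using p by (blast intro: complex_vector.subspace_add[OF M(1)])
      have "(x - p x) + (y - p y) \<in> N" using p by (blast intro: complex_vector.subspace_add[OF N(1)])
      then show "x + y - (p x + p y) \<in> N" by (simp add: algebra_simps)
    qed
    show "p (c *\<^sub>C x) = c *\<^sub>C p x" for c x
    proof (rule uniq)
      show "c *\<^sub>C p x \<in> M" using p by (blast intro: complex_vector.subspace_scale[OF M(1)])
      have "c *\<^sub>C (x - p x) \<in> N" using p by (blast intro: complex_vector.subspace_scale[OF N(1)])
      then show "c *\<^sub>C x - c *\<^sub>C p x \<in> N" by (simp add: complex_vector.scale_right_diff_distrib)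
    qed
    show "p x = x" if "x \<in> M" for x
      using that complex_vector.subspace_0[OF N(1)] by (intro uniq) auto
  qed (use p L in auto)
qed

text \<open>If the descent on \<open>M\<close> is infinite, the stable codimension is positive, and a chain of functionals
  on \<open>S\<^sup>m(M)\<close> exists. Composed with \<open>S\<^sup>m\<close> and the projection onto \<open>M\<close>, both of which commute with \<open>S\<close>,
  it becomes a chain of functionals on the whole space.\<close>

lemma SVEP_imp_finite_descent_on:
  fixes T :: "'a::complex_banach \<Rightarrow> 'a"
  defines "S \<equiv> \<lambda>\<mu> x. T x - \<mu> *\<^sub>C x"
  assumes T: "bounded_clinear T" and Red: "(M, N) \<in> Red (S \<mu>)" and lsF: "lower_semi_Fredholm_on M (S \<mu>)"
    and svep: "has_SVEP_at (cadjoint T) \<mu>"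
  shows "\<exists>q. (S \<mu> ^^ Suc q) ` M = (S \<mu> ^^ q) ` M"
proof -
  let ?S = "S \<mu>"
  have bS: "bounded_clinear ?S" unfolding S_def by (rule bounded_clinear_shift[OF T])
  have M: "csubspace M" "closed M" "?S ` M \<subseteq> M" and N: "?S ` N \<subseteq> N" "csubspace N" and MN: "M \<inter> N = {0}"
    using Red by (auto simp: Red_def)
  obtain B0 where B0: "finite B0" "cspan (?S ` M \<union> B0) = M"
    using lsF by (auto simp: lower_semi_Fredholm_on_iff)
  obtain m B where B: "finite B" "cspan ((?S ^^ Suc m) ` M \<union> B) = (?S ^^ m) ` M"
    and ind: "\<And>k b. b \<in> B \<Longrightarrow> (?S ^^ k) b \<notin> cspan ((?S ^^ Suc (m + k)) ` M \<union> (?S ^^ k) ` (B - {b}))"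
    using finite_codim_iterates_stabilize[OF bS B0] by metis
  have subn: "csubspace ((?S ^^ n) ` M)" for n
    by (rule bounded_clinear_csubspace_image[OF bounded_clinear_funpow[OF bS] M(1)])
  have "B = {}"
  proof (rule ccontr)
    assume ne: "B \<noteq> {}"
    define Y where "Y = (?S ^^ m) ` M"
    have im: "(?S ^^ k) ` Y = (?S ^^ (m + k)) ` M" for k
      unfolding Y_def by (simp add: image_comp funpow_add[symmetric] add.commute)
    have imS: "?S ` Y = (?S ^^ Suc m) ` M" using im[of 1] by simp
    obtain B' where B': "finite B'" "cspan ((?S ^^ m) ` M \<union> B') = M"
      using finite_codim_funpow[OF bS M(1) B0] by blast
    have Y: "csubspace Y" "closed Y" "?S ` Y \<subseteq> Y"
      using subn closed_range_finite_codim[OF bounded_clinear_funpow[OF bS] M(1,2) M(1,2) B'] M(3)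
      unfolding Y_def by (auto simp: funpow_swap1)
    have Bs: "cspan (?S ` Y \<union> B) = Y" using B(2) imS by (simp add: Y_def)
    have ind': "(?S ^^ k) b \<notin> cspan ((?S ^^ Suc k) ` Y \<union> (?S ^^ k) ` (B - {b}))" if "b \<in> B" for k b
      using ind[OF that, of k] im[of "Suc k"] by simp
    obtain \<phi> and C K :: real where K: "K > 0"
      and add: "\<And>n x y. x \<in> Y \<Longrightarrow> y \<in> Y \<Longrightarrow> \<phi> n (x + y) = \<phi> n x + \<phi> n y"
      and sc: "\<And>n c x. x \<in> Y \<Longrightarrow> \<phi> n (c *\<^sub>C x) = c * \<phi> n x"
      and bd: "\<And>n x. x \<in> Y \<Longrightarrow> cmod (\<phi> n x) \<le> C * K ^ n * norm x"
      and ph0: "\<And>x. x \<in> Y \<Longrightarrow> \<phi> 0 (?S x) = 0" and phS: "\<And>n x. x \<in> Y \<Longrightarrow> \<phi> (Suc n) (?S x) = \<phi> n x"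
      and nz: "\<exists>y\<in>Y. \<phi> 0 y \<noteq> 0"
      by (rule functional_chain[OF bS Y B(1) Bs ne ind']) (assumption | rule that)+
    obtain p and L :: real where L: "L > 0" and pM: "\<And>x. p x \<in> M" and pN: "\<And>x. x - p x \<in> N"
      and pbd: "\<And>x. norm (p x) \<le> L * norm x"
      and padd: "\<And>x y. p (x + y) = p x + p y" and psc: "\<And>c x. p (c *\<^sub>C x) = c *\<^sub>C p x"
      and pid: "\<And>x. x \<in> M \<Longrightarrow> p x = x"
      by (rule Red_projection[OF Red]) (assumption | rule that)+
    interpret S: module_hom scaleC scaleC ?S using bounded_clinear_module_hom[OF bS] .
    interpret Sm: module_hom scaleC scaleC "?S ^^ m" using bounded_clinear_module_hom[OF bounded_clinear_funpow[OF bS]] .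
    have pS: "p (?S x) = ?S (p x)" for x
    proof -
      have "p (?S x) - ?S (p x) \<in> M" using pM M(1,3) by (intro complex_vector.subspace_diff) auto
      moreover have "?S (x - p x) \<in> N" using pN[of x] N(1) by blast
      then have "?S (x - p x) - (?S x - p (?S x)) \<in> N" by (rule complex_vector.subspace_diff[OF N(2) _ pN])
      then have "p (?S x) - ?S (p x) \<in> N" by (simp add: S.diff)
      ultimately have "p (?S x) - ?S (p x) = 0" using MN by blast
      then show ?thesis by simp
    qed
    define h where "h x = (?S ^^ m) (p x)" for x
    have hY: "h x \<in> Y" for x using pM by (simp add: h_def Y_def)
    have hS: "h (?S x) = ?S (h x)" for x by (simp add: h_def pS funpow_swap1)
    obtain H where H: "H > 0" "\<And>x. norm ((?S ^^ m) x) \<le> norm x * H"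
      using bounded_linear.pos_bounded[of "?S ^^ m"] bounded_clinear_funpow[OF bS] by (auto simp: bounded_clinear_def)
    have C0: "C \<ge> 0"
    proof -
      obtain y where y: "y \<in> Y" "\<phi> 0 y \<noteq> 0" using nz by blast
      have "0 < C * norm y" using bd[OF y(1), of 0] y(2) by (simp add: less_le_trans[of 0 "cmod (\<phi> 0 y)"])
      then show ?thesis by (simp add: zero_less_mult_iff)
    qed
    have hbd: "norm (h x) \<le> (L * H) * norm x" for x
      using order_trans[OF H(2)[of "p x"] mult_right_mono[OF pbd[of x], of H]] H(1) by (simp add: h_def mult_ac)
    have "\<exists>f. cdual_apply f = (\<lambda>x. \<phi> n (h x)) \<and> norm f \<le> (C * (L * H)) * K ^ n" for n
    proof -
      obtain f where "cdual_apply f = (\<lambda>x. \<phi> n (h x))" "norm f \<le> C * K ^ n * (L * H)"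
      proof (rule cdual_of_functional[of "\<lambda>x. \<phi> n (h x)"])
        show "\<phi> n (h (x + y)) = \<phi> n (h x) + \<phi> n (h y)" for x y
          using add[OF hY hY, of n x y] by (simp add: h_def padd Sm.add)
        show "\<phi> n (h (c *\<^sub>C x)) = c * \<phi> n (h x)" for c x
          using sc[OF hY, of n c x] by (simp add: h_def psc Sm.scale)
        show "cmod (\<phi> n (h x)) \<le> C * K ^ n * (L * H) * norm x" for x
        proof -
          have "cmod (\<phi> n (h x)) \<le> C * K ^ n * norm (h x)" by (rule bd[OF hY])
          also have "\<dots> \<le> C * K ^ n * ((L * H) * norm x)" using hbd C0 K by (intro mult_left_mono) auto
          finally show ?thesis by (simp add: mult.assoc)
        qed
        show "0 \<le> C * K ^ n * (L * H)" using C0 K L H(1) by simp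
      qed
      then show ?thesis by (auto simp: mult_ac)
    qed
    then obtain \<psi> where \<psi>: "\<And>n. cdual_apply (\<psi> n) = (\<lambda>x. \<phi> n (h x))" "\<And>n. norm (\<psi> n) \<le> (C * (L * H)) * K ^ n"
      by metis
    have "\<not> has_SVEP_at (cadjoint T) \<mu>"
    proof (rule not_SVEP_if_functional_chain[OF T K \<psi>(2)])
      show "cdual_apply (\<psi> 0) (T x - \<mu> *\<^sub>C x) = 0" for x
        using ph0[OF hY] hS[of x] by (simp add: \<psi> S_def)
      show "cdual_apply (\<psi> (Suc n)) (T x - \<mu> *\<^sub>C x) = cdual_apply (\<psi> n) x" for n x
        using phS[OF hY] hS[of x] by (simp add: \<psi> S_def)
      obtain x where x: "x \<in> M" "\<phi> 0 ((?S ^^ m) x) \<noteq> 0" using nz by (auto simp: Y_def)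
      then have "cdual_apply (\<psi> 0) x \<noteq> 0" by (simp add: \<psi> h_def pid)
      then show "\<psi> 0 \<noteq> 0" by auto
    qed
    then show False using svep by simp
  qed
  then have "(?S ^^ Suc m) ` M = (?S ^^ m) ` M" using B(2) cspan_csubspace[OF subn[of "Suc m"]] by (simp del: funpow.simps)
  then show ?thesis by blast
qed

section \<open>Finite descent and generalized Drazin surjectivity\<close>

text \<open>Boundedness of the inverse is the open mapping theorem, so that invertibility on a closed
  subspace can be checked algebraically.\<close>

lemma invertible_onI:
  assumes S: "bounded_clinear S" and N: "csubspace N" "closed N" and SN: "S ` N = N"
    and inj: "\<And>x. x \<in> N \<Longrightarrow> S x = 0 \<Longrightarrow> x = 0"
  shows "invertible_on N S"
proof -
  interpret S: module_hom scaleC scaleC S using bounded_clinear_module_hom[OF S] .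
  have bl: "bounded_linear S" using S by (simp add: bounded_clinear_def)
  obtain K where K: "K > 0" "\<forall>w\<in>N. \<exists>e\<in>N. norm e \<le> K * norm w \<and> S e = w"
    using open_mapping_on[OF bl csubspace_imp_subspace[OF N(1)] N(2) csubspace_imp_subspace[OF N(1)] N(2) SN] by auto
  then obtain V where V: "\<And>w. w \<in> N \<Longrightarrow> V w \<in> N \<and> norm (V w) \<le> K * norm w \<and> S (V w) = w" by metis
  have "V (S x) = x" if x: "x \<in> N" for x
  proof -
    have Sx: "S x \<in> N" using SN x by blast
    have "V (S x) - x \<in> N" using V[OF Sx] x by (blast intro: complex_vector.subspace_diff[OF N(1)])
    moreover have "S (V (S x) - x) = 0" using V[OF Sx] by (simp add: S.diff)
    ultimately have "V (S x) - x = 0" by (rule inj)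
    then show ?thesis by simp
  qed
  then show ?thesis using V SN unfolding invertible_on_def by blast
qed

lemma invertible_onD:
  assumes inv: "invertible_on N S" and S: "bounded_clinear S" and N: "csubspace N"
  shows "S ` N = N" and "x \<in> N \<Longrightarrow> S x = 0 \<Longrightarrow> x = 0"
proof -
  interpret S: module_hom scaleC scaleC S using bounded_clinear_module_hom[OF S] .
  obtain V where V: "\<And>x. x \<in> N \<Longrightarrow> S x \<in> N \<and> V x \<in> N \<and> V (S x) = x \<and> S (V x) = x"
    using inv unfolding invertible_on_def by blast
  show "S ` N = N"
  proof
    show "N \<subseteq> S ` N" using V by (metis imageI subsetI)
  qed (use V in blast)
  show "x = 0" if "x \<in> N" "S x = 0"
    using V[OF that(1)] V[OF complex_vector.subspace_0[OF N]] that(2) S.zero by metis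
qed

text \<open>Induction on the order of nilpotency: if \<open>S g = (S - z) h\<close>, then \<open>(S - z) (h - g) = z g\<close>.\<close>

lemma nilpotent_imp_shift_surjective:
  assumes S: "bounded_clinear S" and G: "csubspace G" "S ` G \<subseteq> G" and z: "z \<noteq> 0"
    and g: "g \<in> G" "(S ^^ j) g = 0"
  shows "g \<in> (\<lambda>x. S x - z *\<^sub>C x) ` G"
  using g
proof (induction j arbitrary: g)
  case 0
  have "S 0 = 0" using module_hom.zero[OF bounded_clinear_module_hom[OF S]] .
  then show ?case using 0 by (auto intro!: image_eqI[of _ _ 0])
next
  case (Suc j)
  interpret R: module_hom scaleC scaleC "\<lambda>x. S x - z *\<^sub>C x"
    using bounded_clinear_module_hom[OF bounded_clinear_shift[OF S]] .
  have "S g \<in> G" "(S ^^ j) (S g) = 0" using Suc.prems G(2) by (auto simp: funpow_swap1)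
  then obtain h where h: "h \<in> G" "S g = S h - z *\<^sub>C h" using Suc.IH by blast
  have "S (h - g) - z *\<^sub>C (h - g) = (S h - z *\<^sub>C h) - (S g - z *\<^sub>C g)" by (rule R.diff)
  also have "\<dots> = z *\<^sub>C g" using h(2) by simp
  finally have "S (inverse z *\<^sub>C (h - g)) - z *\<^sub>C inverse z *\<^sub>C (h - g) = inverse z *\<^sub>C z *\<^sub>C g"
    using R.scale[of "inverse z" "h - g"] by simp
  then have "g = S (inverse z *\<^sub>C (h - g)) - z *\<^sub>C inverse z *\<^sub>C (h - g)"
    using z by (simp add: scaleC_scaleC scaleC_one)
  moreover have "inverse z *\<^sub>C (h - g) \<in> G"
    by (intro complex_vector.subspace_scale[OF G(1)] complex_vector.subspace_diff[OF G(1)] h(1) Suc.prems(1))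
  ultimately show ?case by blast
qed

lemma quasi_nilpotent_on_nonzero_shift:
  assumes "quasi_nilpotent_on N S" "z \<noteq> 0"
  shows "invertible_on N (\<lambda>x. S x - z *\<^sub>C x)"
  using assms by (auto simp: quasi_nilpotent_on_def spectrum_on_def)

text \<open>For nonzero \<open>z\<close> the shifted operator \<open>S - z\<close> is bijective on both summands, hence on their direct sum.\<close>

lemma quasi_nilpotent_on_add_nilpotent:
  assumes S: "bounded_clinear S" and N: "csubspace N" "S ` N \<subseteq> N" and qN: "quasi_nilpotent_on N S"
    and G: "csubspace G" "S ` G \<subseteq> G" and nil: "\<And>g. g \<in> G \<Longrightarrow> (S ^^ q) g = 0"
    and NG: "N \<inter> G = {0}" and H: "H = {x + y |x y. x \<in> N \<and> y \<in> G}" "csubspace H" "closed H"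
  shows "quasi_nilpotent_on H S"
  unfolding quasi_nilpotent_on_def spectrum_on_def
proof (intro subsetI CollectI, rule ccontr)
  fix z assume "z \<in> {\<mu>. \<not> invertible_on H (\<lambda>x. S x - \<mu> *\<^sub>C x)}" and "z \<notin> {0}"
  then have ninv: "\<not> invertible_on H (\<lambda>x. S x - z *\<^sub>C x)" and z: "z \<noteq> 0" by auto
  let ?R = "\<lambda>x. S x - z *\<^sub>C x"
  have R: "bounded_clinear ?R" by (rule bounded_clinear_shift[OF S])
  interpret S: module_hom scaleC scaleC S using bounded_clinear_module_hom[OF S] .
  interpret R: module_hom scaleC scaleC ?R using bounded_clinear_module_hom[OF R] .
  note RN = invertible_onD[OF quasi_nilpotent_on_nonzero_shift[OF qN z] R N(1)]
  have RG_sub: "?R ` G \<subseteq> G"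
    using G by (auto intro!: complex_vector.subspace_diff[OF G(1)] complex_vector.subspace_scale[OF G(1)])
  have RG: "?R ` G = G"
    using RG_sub nilpotent_imp_shift_surjective[OF S G z _ nil] by blast
  have G_inj: "g = 0" if g: "g \<in> G" "?R g = 0" for g
  proof -
    have Sg: "S g = z *\<^sub>C g" using g(2) by simp
    have "(S ^^ j) g = z ^ j *\<^sub>C g" for j
      by (induction j) (simp_all add: Sg S.scale scaleC_one scaleC_scaleC mult.commute)
    then have "z ^ q *\<^sub>C g = 0" using nil[OF g(1)] by simp
    then show ?thesis using z by simp
  qed
  have "invertible_on H ?R"
  proof (rule invertible_onI[OF R H(2,3)])
    show "?R ` H = H"
    proof (intro set_eqI iffI)
      fix u assume "u \<in> ?R ` H"
      then obtain x y where xy: "x \<in> N" "y \<in> G" "u = ?R (x + y)" unfolding H(1) by blast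
      have "u = ?R x + ?R y" unfolding xy(3) by (rule R.add)
      moreover have "?R x \<in> N" "?R y \<in> G" using RN(1) RG xy by blast+
      ultimately show "u \<in> H" unfolding H(1) by blast
    next
      fix u assume "u \<in> H"
      then obtain x y where xy: "x \<in> N" "y \<in> G" "u = x + y" unfolding H(1) by blast
      have "x \<in> ?R ` N" "y \<in> ?R ` G" using xy RN(1) RG by simp_all
      then obtain x' y' where xy': "x' \<in> N" "x = ?R x'" "y' \<in> G" "y = ?R y'" by blast
      have "u = ?R (x' + y')" unfolding xy(3) xy'(2) xy'(4) by (rule R.add[symmetric])
      moreover have "x' + y' \<in> H" using xy' unfolding H(1) by blast
      ultimately show "u \<in> ?R ` H" by blast
    qed
    fix u assume u: "u \<in> H" "?R u = 0"
    then obtain x y where xy: "x \<in> N" "y \<in> G" "u = x + y" unfolding H(1) by blast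
    have "?R x + ?R y = 0" using u(2) unfolding xy(3) R.add .
    then have eq: "?R x = - ?R y" by (simp only: eq_neg_iff_add_eq_0)
    have "?R x \<in> N" using RN(1) xy by blast
    moreover have "?R y \<in> G" using RG xy by blast
    then have "?R x \<in> G" unfolding eq by (rule complex_vector.subspace_neg[OF G(1)])
    ultimately have Rx: "?R x = 0" using NG by blast
    then have "?R y = 0" using eq by simp
    then show "u = 0" using RN(2)[OF xy(1) Rx] G_inj[OF xy(2)] xy(3) by simp
  qed
  then show False using ninv by simp
qed

text \<open>Since \<open>S(R) = R\<close>, the \<open>R\<close>-component of \<open>S x\<close> is \<open>S r'\<close> for some \<open>r' \<in> R\<close>. The vector \<open>x - r'\<close> is then
  mapped by \<open>S\<close> into the span of \<open>C\<close> and can be adjoined to \<open>C\<close>.\<close>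

lemma extend_invariant_complement:
  assumes S: "bounded_clinear S" and R: "csubspace R" "S ` R = R" and M: "csubspace M" "R \<subseteq> M"
    and C: "finite C" "cspan C \<subseteq> M" "S ` cspan C \<subseteq> cspan C" "cspan C \<inter> R = {0}"
    and x: "x \<in> M" "S x \<in> cspan (R \<union> C)"
  shows "\<exists>C'. finite C' \<and> cspan C' \<subseteq> M \<and> S ` cspan C' \<subseteq> cspan C' \<and> cspan C' \<inter> R = {0} \<and>
    cspan C \<subseteq> cspan C' \<and> x \<in> cspan (R \<union> C')"
proof (cases "x \<in> cspan (R \<union> C)")
  case False
  interpret S: module_hom scaleC scaleC S using bounded_clinear_module_hom[OF S] .
  obtain r g where rg: "r \<in> R" "g \<in> cspan C" "S x = r + g"
    using x(2) cspan_Un_subspace[OF R(1), of C] by auto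
  obtain r' where r': "r' \<in> R" "r = S r'" using rg(1) R(2) by blast
  define y where "y = x - r'"
  have Sy: "S y = g" using rg(3) r'(2) by (simp add: y_def S.diff)
  have y_notin: "y \<notin> cspan (R \<union> C)"
  proof
    assume "y \<in> cspan (R \<union> C)"
    moreover have "r' \<in> cspan (R \<union> C)" using r' by (simp add: complex_vector.span_base)
    ultimately have "y + r' \<in> cspan (R \<union> C)" by (rule complex_vector.span_add)
    then show False using False by (simp add: y_def)
  qed
  have sub: "cspan C \<subseteq> cspan (insert y C)" by (rule complex_vector.span_mono) auto
  have "y \<in> M" using x r' M by (auto simp: y_def intro: complex_vector.subspace_diff)
  then have "cspan (insert y C) \<subseteq> M"
    using C(2) M(1) complex_vector.span_superset[of C] by (intro complex_vector.span_minimal) auto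
  moreover have "S ` cspan (insert y C) \<subseteq> cspan (insert y C)"
  proof -
    have "S ` insert y C \<subseteq> cspan C" using Sy rg(2) C(3) complex_vector.span_superset[of C] by auto
    then have "cspan (S ` insert y C) \<subseteq> cspan C" by (rule complex_vector.span_minimal) simp
    then show ?thesis using sub by (simp only: bounded_clinear_cspan_image[OF S])
  qed
  moreover have "u = 0" if u: "u \<in> cspan (insert y C)" "u \<in> R" for u
  proof -
    obtain k where k: "u - k *\<^sub>C y \<in> cspan C" using u(1) by (auto simp: complex_vector.span_breakdown_eq)
    then have "u - k *\<^sub>C y \<in> cspan (R \<union> C)" using complex_vector.span_mono[of C "R \<union> C"] by auto
    moreover have "u \<in> cspan (R \<union> C)" using u(2) by (simp add: complex_vector.span_base)
    ultimately have "k *\<^sub>C y \<in> cspan (R \<union> C)" using complex_vector.span_diff by fastforce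
    then have "k = 0" using y_notin by (rule cspan_scale_cancel)
    then show ?thesis using k C(4) u(2) by auto
  qed
  then have "cspan (insert y C) \<inter> R = {0}"
    using complex_vector.subspace_0[OF R(1)] complex_vector.span_zero by blast
  moreover have "x \<in> cspan (R \<union> insert y C)"
  proof -
    have "y + r' \<in> cspan (R \<union> insert y C)" using r' by (intro complex_vector.span_add complex_vector.span_base) auto
    then show ?thesis by (simp add: y_def)
  qed
  ultimately show ?thesis using C(1) sub by (intro exI[of _ "insert y C"]) auto
qed (use C in blast)

lemma extend_invariant_complement_funpow:
  assumes S: "bounded_clinear S" and R: "csubspace R" "S ` R = R" and M: "csubspace M" "R \<subseteq> M" "S ` M \<subseteq> M"
    and C: "finite C" "cspan C \<subseteq> M" "S ` cspan C \<subseteq> cspan C" "cspan C \<inter> R = {0}"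
    and x: "x \<in> M" "(S ^^ j) x \<in> R"
  shows "\<exists>C'. finite C' \<and> cspan C' \<subseteq> M \<and> S ` cspan C' \<subseteq> cspan C' \<and> cspan C' \<inter> R = {0} \<and>
    cspan C \<subseteq> cspan C' \<and> x \<in> cspan (R \<union> C')"
  using x
proof (induction j arbitrary: x)
  case 0
  then have "x \<in> cspan (R \<union> C)" by (simp add: complex_vector.span_base)
  then show ?case using C by blast
next
  case (Suc j)
  have "S x \<in> M" "(S ^^ j) (S x) \<in> R" using Suc.prems M(3) by (auto simp: funpow_swap1)
  from Suc.IH[OF this] obtain C1 where C1: "finite C1" "cspan C1 \<subseteq> M" "S ` cspan C1 \<subseteq> cspan C1"
    "cspan C1 \<inter> R = {0}" "cspan C \<subseteq> cspan C1" "S x \<in> cspan (R \<union> C1)" by blast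
  from extend_invariant_complement[OF S R M(1,2) C1(1-4) Suc.prems(1) C1(6)] C1(5) show ?case
    by (meson order_trans)
qed

lemma invariant_finite_complement:
  assumes S: "bounded_clinear S" and R: "csubspace R" "S ` R = R" and M: "csubspace M" "R \<subseteq> M" "S ` M \<subseteq> M"
    and q: "(S ^^ q) ` M \<subseteq> R" and B: "finite B" "cspan (R \<union> B) = M"
  shows "\<exists>C. finite C \<and> cspan C \<subseteq> M \<and> S ` cspan C \<subseteq> cspan C \<and> cspan C \<inter> R = {0} \<and> cspan (R \<union> C) = M"
proof -
  have BM: "B \<subseteq> M" using B(2) complex_vector.span_superset[of "R \<union> B"] by auto
  have "\<exists>C. finite C \<and> cspan C \<subseteq> M \<and> S ` cspan C \<subseteq> cspan C \<and> cspan C \<inter> R = {0} \<and> B \<subseteq> cspan (R \<union> C)"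
    using B(1) BM
  proof (induction B)
    case empty
    have "S 0 = 0" using module_hom.zero[OF bounded_clinear_module_hom[OF S]] .
    then show ?case using R(1) M(1) by (intro exI[of _ "{}"]) (auto simp: complex_vector.subspace_0)
  next
    case (insert b B)
    then obtain C where C: "finite C" "cspan C \<subseteq> M" "S ` cspan C \<subseteq> cspan C" "cspan C \<inter> R = {0}"
      "B \<subseteq> cspan (R \<union> C)" by auto
    have "b \<in> M" "(S ^^ q) b \<in> R" using insert.prems q by auto
    from extend_invariant_complement_funpow[OF S R M C(1-4) this]
    obtain C' where C': "finite C'" "cspan C' \<subseteq> M" "S ` cspan C' \<subseteq> cspan C'" "cspan C' \<inter> R = {0}"
      "cspan C \<subseteq> cspan C'" "b \<in> cspan (R \<union> C')" by blast
    have "R \<union> C \<subseteq> cspan (R \<union> C')"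
      using C'(5) complex_vector.span_superset[of C] complex_vector.span_mono[of C' "R \<union> C'"] complex_vector.span_superset[of "R \<union> C'"]
      by blast
    then have "cspan (R \<union> C) \<subseteq> cspan (R \<union> C')" by (rule complex_vector.span_minimal) simp
    then show ?case using C' C(5) by blast
  qed
  then obtain C where C: "finite C" "cspan C \<subseteq> M" "S ` cspan C \<subseteq> cspan C" "cspan C \<inter> R = {0}" "B \<subseteq> cspan (R \<union> C)" by blast
  have "cspan (R \<union> C) \<subseteq> M" using C(2) M complex_vector.span_superset[of C] by (intro complex_vector.span_minimal) auto
  moreover have "cspan (R \<union> B) \<subseteq> cspan (R \<union> C)"
    using C(5) complex_vector.span_superset[of "R \<union> C"] by (intro complex_vector.span_minimal) auto
  ultimately show ?thesis using C B(2) by blast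
qed

text \<open>At descent \<open>q\<close> the space \<open>R = S\<^sup>q(M)\<close> satisfies \<open>S(R) = R\<close> and has an invariant finite-dimensional
  complement \<open>G\<close> in \<open>M\<close>. On \<open>G\<close> the operator is nilpotent, as \<open>S\<^sup>q(G) \<subseteq> G \<inter> R\<close>. Moving \<open>G\<close> over to \<open>N\<close> gives
  the required decomposition.\<close>

lemma finite_descent_imp_generalized_Drazin_surjective:
  assumes S: "bounded_clinear S" and Red: "(M, N) \<in> Red S" and lsF: "lower_semi_Fredholm_on M S"
    and qN: "quasi_nilpotent_on N S" and q: "(S ^^ Suc q) ` M = (S ^^ q) ` M"
  shows "generalized_Drazin_surjective S"
proof -
  have M: "csubspace M" "closed M" "S ` M \<subseteq> M" and N: "csubspace N" "closed N" "S ` N \<subseteq> N"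
    and MN: "M \<inter> N = {0}" and sum: "{x + y |x y. x \<in> M \<and> y \<in> N} = UNIV"
    using Red by (auto simp: Red_def)
  define R where "R = (S ^^ q) ` M"
  obtain B0 where B0: "finite B0" "cspan (S ` M \<union> B0) = M" using lsF by (auto simp: lower_semi_Fredholm_on_iff)
  obtain B where B: "finite B" "cspan (R \<union> B) = M"
    using finite_codim_funpow[OF S M(1) B0, of q] unfolding R_def by auto
  have R: "csubspace R" "closed R"
    using bounded_clinear_csubspace_image[OF bounded_clinear_funpow[OF S] M(1)]
      closed_range_finite_codim[OF bounded_clinear_funpow[OF S] M(1,2) M(1,2) B[unfolded R_def]]
    by (simp_all add: R_def)
  have SR: "S ` R = R" using q by (simp add: R_def image_image)
  have RM: "R \<subseteq> M" using B(2) complex_vector.span_superset[of "R \<union> B"] by auto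
  obtain C where C: "finite C" "cspan C \<subseteq> M" "S ` cspan C \<subseteq> cspan C" "cspan C \<inter> R = {0}" "cspan (R \<union> C) = M"
    using invariant_finite_complement[OF S R(1) SR M(1) RM M(3) _ B, of q] unfolding R_def by auto
  define G where "G = cspan C"
  have G: "csubspace G" "S ` G \<subseteq> G" "G \<subseteq> M" "G \<inter> R = {0}" using C by (simp_all add: G_def)
  have NG: "N \<inter> G = {0}"
    using MN G(3) complex_vector.subspace_0[OF N(1)] complex_vector.subspace_0[OF G(1)] by blast
  have nil: "(S ^^ q) g = 0" if g: "g \<in> G" for g
  proof -
    have "(S ^^ j) g \<in> G" for j by (induction j) (use g G(2) in auto)
    moreover have "(S ^^ q) g \<in> R" using g G(3) by (auto simp: R_def)
    ultimately show ?thesis using G(4) by blast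
  qed
  define H where "H = cspan (N \<union> C)"
  have H_eq: "H = {x + y |x y. x \<in> N \<and> y \<in> G}" unfolding H_def G_def by (rule cspan_Un_subspace[OF N(1)])
  have H: "csubspace H" "closed H" using closed_cspan_Un_finite[OF N(1,2) C(1)] by (simp_all add: H_def)
  have SH: "S ` H \<subseteq> H"
  proof -
    have "S ` (N \<union> C) \<subseteq> H"
    proof -
      have "S ` N \<subseteq> H" using N(3) complex_vector.span_superset[of "N \<union> C"] by (auto simp: H_def)
      moreover have "cspan C \<subseteq> H" unfolding H_def by (rule complex_vector.span_mono) auto
      then have "S ` C \<subseteq> H" using C(3) complex_vector.span_superset[of C] by auto
      ultimately show ?thesis by auto
    qed
    then have "cspan (S ` (N \<union> C)) \<subseteq> H" by (rule complex_vector.span_minimal) (rule H(1))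
    then show ?thesis by (simp add: H_def bounded_clinear_cspan_image[OF S])
  qed
  have "(R, H) \<in> Red S"
  proof -
    have "x = 0" if x: "x \<in> R" "x \<in> H" for x
    proof -
      obtain n g where ng: "n \<in> N" "g \<in> G" "x = n + g" using x(2) unfolding H_eq by blast
      have "x \<in> M" "g \<in> M" using x(1) RM ng(2) G(3) by auto
      then have "x - g \<in> M" by (rule complex_vector.subspace_diff[OF M(1)])
      then have "n = 0" using ng MN by auto
      then show ?thesis using ng x(1) G(4) by auto
    qed
    then have cap: "R \<inter> H = {0}" using complex_vector.subspace_0[OF R(1)] complex_vector.subspace_0[OF H(1)] by blast
    have "x \<in> {x + y |x y. x \<in> R \<and> y \<in> H}" for x
    proof -
      have "x \<in> {x + y |x y. x \<in> M \<and> y \<in> N}" using sum by simp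
      then obtain m n where mn: "m \<in> M" "n \<in> N" "x = m + n" by blast
      have "m \<in> {x + y |x y. x \<in> R \<and> y \<in> cspan C}" using mn(1) C(5) cspan_Un_subspace[OF R(1), of C] by simp
      then obtain r g where rg: "r \<in> R" "g \<in> G" "m = r + g" unfolding G_def by blast
      have "n + g \<in> H" using mn(2) rg(2) unfolding H_eq by blast
      moreover have "x = r + (n + g)" using mn(3) rg(3) by simp
      ultimately show ?thesis using rg(1) by blast
    qed
    then have "{x + y |x y. x \<in> R \<and> y \<in> H} = UNIV" by blast
    then show ?thesis unfolding Red_def using R H SH SR cap by simp
  qed
  moreover have "quasi_nilpotent_on H S"
    by (rule quasi_nilpotent_on_add_nilpotent[OF S N(1,3) qN G(1,2) nil NG H_eq H])
  ultimately show ?thesis unfolding generalized_Drazin_surjective_def using SR by blast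
qed

section \<open>Small shifts and the single valued extension property\<close>

lemma range_modulo_finite_stable:
  fixes S :: "'a::complex_banach \<Rightarrow> 'a"
  assumes S: "bounded_clinear S" and M: "csubspace M" "closed M" "S ` M \<subseteq> M" and B: "finite B" "cspan (S ` M \<union> B) = M"
  shows "\<exists>r>0. \<forall>z. cmod z < r \<longrightarrow> cspan ((\<lambda>x. S x - z *\<^sub>C x) ` M \<union> B) = M"
proof -
  let ?D = "\<lambda>z p. (S (fst p) - z *\<^sub>C fst p) + snd p"
  let ?E = "M \<times> cspan B"
  have sM: "subspace M" by (rule csubspace_imp_subspace[OF M(1)])
  note om = open_mapping_modulo_finite[OF S M(1,2) M(1,2) B]
  obtain r where r: "r > 0" "\<forall>C. bounded_linear C \<longrightarrow> C ` ?E \<subseteq> M \<longrightarrow>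
      (\<forall>e\<in>?E. norm ((S (fst e) + snd e) - C e) \<le> r * norm e) \<longrightarrow> C ` ?E = M"
    using surjective_on_perturbation[OF om(1) om(3,4) sM M(2) om(2)] by auto
  have BM: "cspan B \<subseteq> M" using B(2) complex_vector.span_mono[of B "S ` M \<union> B"] by simp
  have "cspan ((\<lambda>x. S x - z *\<^sub>C x) ` M \<union> B) = M" if z: "cmod z < r" for z
  proof -
    have Sz: "bounded_clinear (\<lambda>x. S x - z *\<^sub>C x)" by (rule bounded_clinear_shift[OF S])
    have SzM: "S x - z *\<^sub>C x \<in> M" if "x \<in> M" for x
      using that M(3) by (intro complex_vector.subspace_diff[OF M(1)] complex_vector.subspace_scale[OF M(1)]) auto
    have "bounded_linear (?D z)"
      using Sz by (intro bounded_linear_add bounded_linear_snd bounded_linear_compose[OF _ bounded_linear_fst, of "\<lambda>x. S x - z *\<^sub>C x"])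
        (simp add: bounded_clinear_def)
    moreover have "?D z ` ?E \<subseteq> M" using SzM BM by (auto intro!: complex_vector.subspace_add[OF M(1)])
    moreover have "norm ((S (fst e) + snd e) - ?D z e) \<le> r * norm e" for e
    proof -
      have "norm ((S (fst e) + snd e) - ?D z e) = cmod z * norm (fst e)" by (simp add: norm_scaleC)
      also have "\<dots> \<le> r * norm e" using z r(1) by (intro mult_mono) (auto simp: norm_fst_le[of "fst e" "snd e", simplified])
      finally show ?thesis .
    qed
    ultimately have DM: "?D z ` ?E = M" using r(2) by blast
    have "cspan ((\<lambda>x. S x - z *\<^sub>C x) ` M \<union> B) = {x + y |x y. x \<in> (\<lambda>x. S x - z *\<^sub>C x) ` M \<and> y \<in> cspan B}"
      by (rule cspan_Un_subspace[OF bounded_clinear_csubspace_image[OF Sz M(1)]])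
    also have "\<dots> = ?D z ` ?E"
    proof (intro set_eqI iffI)
      fix u assume "u \<in> {x + y |x y. x \<in> (\<lambda>x. S x - z *\<^sub>C x) ` M \<and> y \<in> cspan B}"
      then obtain x y where "x \<in> M" "y \<in> cspan B" "u = (S x - z *\<^sub>C x) + y" by blast
      then show "u \<in> ?D z ` ?E" by (intro image_eqI[of _ _ "(x, y)"]) auto
    next
      fix u assume "u \<in> ?D z ` ?E"
      then obtain x y where "x \<in> M" "y \<in> cspan B" "u = (S x - z *\<^sub>C x) + y" by auto
      then show "u \<in> {x + y |x y. x \<in> (\<lambda>x. S x - z *\<^sub>C x) ` M \<and> y \<in> cspan B}" by blast
    qed
    finally show ?thesis using DM by simp
  qed
  then show ?thesis using r(1) by blast
qed

text \<open>A small nonzero shift makes \<open>S\<close> invertible on \<open>N\<close> and does not destroy \<open>S(M) + span B = M\<close>. With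
  \<open>B = {}\<close> this gives surjectivity near \<open>0\<close>, in general the lower semi-Fredholm property.\<close>

lemma range_shift_modulo_finite:
  fixes S :: "'a::complex_banach \<Rightarrow> 'a"
  assumes S: "bounded_clinear S" and Red: "(M, N) \<in> Red S"
    and qN: "quasi_nilpotent_on N S" and B: "finite B" "cspan (S ` M \<union> B) = M"
  shows "\<exists>r>0. \<forall>z. z \<noteq> 0 \<longrightarrow> cmod z < r \<longrightarrow> cspan (range (\<lambda>x. S x - z *\<^sub>C x) \<union> B) = UNIV"
proof -
  have M: "csubspace M" "closed M" "S ` M \<subseteq> M" and N: "csubspace N"
    and sum: "{x + y |x y. x \<in> M \<and> y \<in> N} = UNIV" using Red by (auto simp: Red_def)
  obtain r where r: "r > 0" "\<forall>z. cmod z < r \<longrightarrow> cspan ((\<lambda>x. S x - z *\<^sub>C x) ` M \<union> B) = M"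
    using range_modulo_finite_stable[OF S M B] by auto
  have "cspan (range (\<lambda>x. S x - z *\<^sub>C x) \<union> B) = UNIV" if z: "z \<noteq> 0" "cmod z < r" for z
  proof -
    let ?R = "\<lambda>x. S x - z *\<^sub>C x"
    have RN: "?R ` N = N"
      by (rule invertible_onD(1)[OF quasi_nilpotent_on_nonzero_shift[OF qN z(1)] bounded_clinear_shift[OF S] N])
    have "u \<in> cspan (range ?R \<union> B)" for u
    proof -
      have "u \<in> {x + y |x y. x \<in> M \<and> y \<in> N}" using sum by simp
      then obtain m n where mn: "m \<in> M" "n \<in> N" "u = m + n" by blast
      have "m \<in> cspan (?R ` M \<union> B)" using mn(1) r(2) z(2) by simp
      moreover have "cspan (?R ` M \<union> B) \<subseteq> cspan (range ?R \<union> B)" by (rule complex_vector.span_mono) auto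
      ultimately have "m \<in> cspan (range ?R \<union> B)" by blast
      moreover have "n \<in> range ?R" using RN mn(2) by blast
      then have "n \<in> cspan (range ?R \<union> B)" by (intro complex_vector.span_base) simp
      ultimately show ?thesis unfolding mn(3) by (rule complex_vector.span_add)
    qed
    then show ?thesis by blast
  qed
  then show ?thesis using r(1) by blast
qed

text \<open>A functional \<open>f z\<close> with \<open>T\<^sup>* (f z) = z f z\<close> annihilates the range of \<open>T - z\<close>, so \<open>f\<close> vanishes on a
  punctured disc around \<open>\<mu>\<close>. The identity theorem for the scalar functions \<open>z \<mapsto> f z x\<close> does the rest.\<close>

lemma SVEP_if_surjective_near:
  fixes T :: "'a::complex_banach \<Rightarrow> 'a"
  assumes T: "bounded_clinear T" and r: "r > 0"
    and surj: "\<And>z. z \<noteq> 0 \<Longrightarrow> cmod z < r \<Longrightarrow> range (\<lambda>x. (T x - \<mu> *\<^sub>C x) - z *\<^sub>C x) = UNIV"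
  shows "has_SVEP_at (cadjoint T) \<mu>"
  unfolding has_SVEP_at_def
proof (intro allI impI ballI, elim conjE)
  fix U f w
  assume U: "open U" "connected U" "\<mu> \<in> U" and an: "banach_analytic_on f U"
    and eq: "\<forall>z\<in>U. cadjoint T (f z) - z *\<^sub>C f z = 0" and w: "w \<in> U"
  have zero: "f z = 0" if z: "z \<in> U" "z \<noteq> \<mu>" "dist \<mu> z < r" for z
  proof (rule cdual_eqI)
    fix y
    have "range (\<lambda>x. (T x - \<mu> *\<^sub>C x) - (z - \<mu>) *\<^sub>C x) = UNIV"
      using z by (intro surj) (auto simp: dist_norm norm_minus_commute)
    then have "y \<in> range (\<lambda>x. (T x - \<mu> *\<^sub>C x) - (z - \<mu>) *\<^sub>C x)" by simp
    then obtain x where "y = (T x - \<mu> *\<^sub>C x) - (z - \<mu>) *\<^sub>C x" by blast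
    then have x: "y = T x - z *\<^sub>C x" by (simp add: complex_vector.scale_left_diff_distrib)
    have "cdual_apply (cadjoint T (f z) - z *\<^sub>C f z) x = 0" using eq z(1) by simp
    then show "cdual_apply (f z) y = cdual_apply 0 y"
      by (simp add: x cdual_apply_diff cdual_apply_diff_right cdual_apply_scaleC cdual_apply_scaleC_right
          cdual_apply_cadjoint[OF T])
  qed
  show "f w = 0"
  proof (rule cdual_eqI)
    fix x
    let ?g = "\<lambda>z. cdual_apply (f z) x"
    have hol: "?g holomorphic_on U"
      unfolding holomorphic_on_open[OF U(1)]
    proof (intro ballI)
      fix z assume "z \<in> U"
      then obtain D where "(f has_derivative (\<lambda>h. h *\<^sub>C D)) (at z)" using an by (auto simp: banach_analytic_on_def)
      from bounded_linear.has_derivative[OF bounded_linear_cdual_apply_left this, of x]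
      have "(?g has_derivative (\<lambda>h. cdual_apply D x * h)) (at z)" by (simp add: cdual_apply_scaleC mult.commute)
      then show "\<exists>D. (?g has_field_derivative D) (at z)" by (auto simp: has_field_derivative_def)
    qed
    obtain e where e: "e > 0" "ball \<mu> e \<subseteq> U" using U openE by blast
    let ?s = "ball \<mu> (min e r) - {\<mu>}"
    have "\<mu> islimpt ?s"
    proof -
      have "\<mu> islimpt ball \<mu> (min e r)" using e r by (simp add: islimpt_ball)
      then show ?thesis by (metis islimpt_insert insert_Diff_single)
    qed
    then have "?g w = 0"
      using e zero by (intro analytic_continuation[OF hol U(1,2) _ U(3) _ _ w, of ?s]) auto
    then show "cdual_apply (f w) x = cdual_apply 0 x" by simp
  qed
qed

lemma generalized_Drazin_surjective_imp_SVEP: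
  fixes T :: "'a::complex_banach \<Rightarrow> 'a"
  assumes T: "bounded_clinear T" and gD: "generalized_Drazin_surjective (\<lambda>x. T x - \<mu> *\<^sub>C x)"
  shows "has_SVEP_at (cadjoint T) \<mu>"
proof -
  let ?S = "\<lambda>x. T x - \<mu> *\<^sub>C x"
  have S: "bounded_clinear ?S" by (rule bounded_clinear_shift[OF T])
  obtain M N where MN: "(M, N) \<in> Red ?S" "?S ` M = M" "quasi_nilpotent_on N ?S"
    using gD unfolding generalized_Drazin_surjective_def by blast
  have "csubspace M" using MN(1) by (simp add: Red_def)
  then have "cspan (?S ` M \<union> {}) = M" using MN(2) by simp
  from range_shift_modulo_finite[OF S MN(1,3) _ this]
  obtain r where r: "r > 0" "\<And>z. z \<noteq> 0 \<Longrightarrow> cmod z < r \<Longrightarrow> cspan (range (\<lambda>x. ?S x - z *\<^sub>C x) \<union> {}) = UNIV"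
    by auto
  have "range (\<lambda>x. ?S x - z *\<^sub>C x) = UNIV" if "z \<noteq> 0" "cmod z < r" for z
    using r(2)[OF that] cspan_csubspace[OF bounded_clinear_csubspace_image[OF bounded_clinear_shift[OF S] complex_vector.subspace_UNIV], of z]
    by simp
  then show ?thesis using SVEP_if_surjective_near[OF T r(1)] by blast
qed

lemma pseudo_lower_B_Fredholm_imp_lower_semi_Fredholm_near:
  fixes S :: "'a::complex_banach \<Rightarrow> 'a"
  assumes S: "bounded_clinear S" and pl: "pseudo_lower_B_Fredholm S"
  shows "\<exists>r>0. \<forall>z. z \<noteq> 0 \<longrightarrow> cmod z < r \<longrightarrow> lower_semi_Fredholm (\<lambda>x. S x - z *\<^sub>C x)"
proof -
  obtain M N where MN: "(M, N) \<in> Red S" "lower_semi_Fredholm_on M S" "quasi_nilpotent_on N S"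
    using pl unfolding pseudo_lower_B_Fredholm_def by blast
  obtain B where B: "finite B" "cspan (S ` M \<union> B) = M" using MN(2) by (auto simp: lower_semi_Fredholm_on_iff)
  show ?thesis using range_shift_modulo_finite[OF S MN(1,3) B] B(1) unfolding lower_semi_Fredholm_on_iff by blast
qed

section \<open>Equality of spectra\<close>

lemma Red_UNIV: "bounded_clinear S \<Longrightarrow> (UNIV, {0}) \<in> Red S"
  using module_hom.zero[OF bounded_clinear_module_hom[of S]]
  by (auto simp: Red_def complex_vector.subspace_UNIV complex_vector.subspace_single_0)

lemma quasi_nilpotent_on_0:
  assumes "bounded_clinear S"
  shows "quasi_nilpotent_on {0} S"
proof -
  have "S 0 = 0" using module_hom.zero[OF bounded_clinear_module_hom[OF assms]] .
  then have "invertible_on {0} (\<lambda>x. S x - z *\<^sub>C x)" for z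
    unfolding invertible_on_def by (intro exI[of _ "\<lambda>_. 0"]) simp
  then show ?thesis by (simp add: quasi_nilpotent_on_def spectrum_on_def)
qed

lemma descent_finite_iff: "descent S < \<infinity> \<longleftrightarrow> (\<exists>q. (S ^^ Suc q) ` UNIV = (S ^^ q) ` UNIV)"
proof -
  have "descent S < \<infinity> \<longleftrightarrow> {enat q |q. range (S ^^ q) = range (S ^^ (q + 1))} \<noteq> {}"
    unfolding descent_def by (rule Inf_enat_less_infinity_iff) simp
  also have "\<dots> \<longleftrightarrow> (\<exists>q. range (S ^^ q) = range (S ^^ (q + 1)))" by blast
  also have "\<dots> \<longleftrightarrow> (\<exists>q. (S ^^ Suc q) ` UNIV = (S ^^ q) ` UNIV)" by (metis Suc_eq_plus1)
  finally show ?thesis .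
qed

theorem theorem2p5:
  fixes T :: "'a::complex_banach \<Rightarrow> 'a"
  assumes "bounded_clinear T"
  shows "(sigma_lf T = sigma_lB T \<longleftrightarrow> (\<forall>\<mu>. \<mu> \<notin> sigma_lf T \<longrightarrow> has_SVEP_at (cadjoint T) \<mu>)) \<and>
         ((\<forall>\<mu>. \<mu> \<notin> sigma_lf T \<longrightarrow> has_SVEP_at (cadjoint T) \<mu>) \<longleftrightarrow>
            (\<forall>\<mu>. \<mu> \<notin> sigma_plBF T \<longrightarrow> has_SVEP_at (cadjoint T) \<mu>)) \<and>
         ((\<forall>\<mu>. \<mu> \<notin> sigma_plBF T \<longrightarrow> has_SVEP_at (cadjoint T) \<mu>) \<longleftrightarrow>
            sigma_gDQ T = sigma_plBF T)"
proof -
  let ?S = "\<lambda>\<mu> x. T x - \<mu> *\<^sub>C x"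
  have S: "bounded_clinear (?S \<mu>)" for \<mu> by (rule bounded_clinear_shift[OF assms])
  have Browder_SVEP: "lower_semi_Browder (?S \<mu>) \<longleftrightarrow> has_SVEP_at (cadjoint T) \<mu>"
    if lf: "lower_semi_Fredholm (?S \<mu>)" for \<mu>
  proof
    assume "lower_semi_Browder (?S \<mu>)"
    then obtain q where "(?S \<mu> ^^ Suc q) ` UNIV = (?S \<mu> ^^ q) ` UNIV"
      unfolding lower_semi_Browder_def descent_finite_iff by blast
    then have "generalized_Drazin_surjective (?S \<mu>)"
      by (rule finite_descent_imp_generalized_Drazin_surjective[OF S Red_UNIV[OF S] lf quasi_nilpotent_on_0[OF S]])
    then show "has_SVEP_at (cadjoint T) \<mu>" by (rule generalized_Drazin_surjective_imp_SVEP[OF assms])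
  next
    assume "has_SVEP_at (cadjoint T) \<mu>"
    then show "lower_semi_Browder (?S \<mu>)"
      using SVEP_imp_finite_descent_on[OF assms Red_UNIV[OF S] lf] lf
      unfolding lower_semi_Browder_def descent_finite_iff by blast
  qed
  have gDQ_SVEP: "generalized_Drazin_surjective (?S \<mu>) \<longleftrightarrow> has_SVEP_at (cadjoint T) \<mu>"
    if pl: "pseudo_lower_B_Fredholm (?S \<mu>)" for \<mu>
  proof
    assume svep: "has_SVEP_at (cadjoint T) \<mu>"
    obtain M N where MN: "(M, N) \<in> Red (?S \<mu>)" "lower_semi_Fredholm_on M (?S \<mu>)" "quasi_nilpotent_on N (?S \<mu>)"
      using pl unfolding pseudo_lower_B_Fredholm_def by blast
    obtain q where "(?S \<mu> ^^ Suc q) ` M = (?S \<mu> ^^ q) ` M"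
      using SVEP_imp_finite_descent_on[OF assms MN(1,2) svep] by blast
    then show "generalized_Drazin_surjective (?S \<mu>)"
      by (rule finite_descent_imp_generalized_Drazin_surjective[OF S MN])
  qed (rule generalized_Drazin_surjective_imp_SVEP[OF assms])
  have gDQ_pl: "pseudo_lower_B_Fredholm (?S \<mu>)" if gD: "generalized_Drazin_surjective (?S \<mu>)" for \<mu>
  proof -
    obtain M N where MN: "(M, N) \<in> Red (?S \<mu>)" "?S \<mu> ` M = M" "quasi_nilpotent_on N (?S \<mu>)"
      using gD unfolding generalized_Drazin_surjective_def by blast
    have "csubspace M" using MN(1) by (simp add: Red_def)
    then have "lower_semi_Fredholm_on M (?S \<mu>)"
      unfolding lower_semi_Fredholm_on_iff using MN(2) by (intro exI[of _ "{}"]) simp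
    then show ?thesis unfolding pseudo_lower_B_Fredholm_def using MN by blast
  qed
  have lf_pl: "pseudo_lower_B_Fredholm (?S \<mu>)" if "lower_semi_Fredholm (?S \<mu>)" for \<mu>
    unfolding pseudo_lower_B_Fredholm_def using Red_UNIV[OF S] quasi_nilpotent_on_0[OF S] that by blast
  have SVEP_spread: "has_SVEP_at (cadjoint T) \<mu>"
    if all: "\<forall>\<mu>. \<mu> \<notin> sigma_lf T \<longrightarrow> has_SVEP_at (cadjoint T) \<mu>" and pl: "pseudo_lower_B_Fredholm (?S \<mu>)" for \<mu>
  proof -
    obtain r where r: "r > 0" "\<And>z. z \<noteq> 0 \<Longrightarrow> cmod z < r \<Longrightarrow> lower_semi_Fredholm (\<lambda>x. ?S \<mu> x - z *\<^sub>C x)"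
      using pseudo_lower_B_Fredholm_imp_lower_semi_Fredholm_near[OF S pl] by blast
    show ?thesis
      unfolding has_SVEP_at_def
    proof (intro allI impI)
      fix U f
      assume A: "open U \<and> connected U \<and> \<mu> \<in> U \<and> banach_analytic_on f U \<and>
        (\<forall>z\<in>U. cadjoint T (f z) - z *\<^sub>C f z = 0)"
      obtain e where e: "e > 0" "ball \<mu> e \<subseteq> U" using A openE by blast
      \<comment> \<open>\<open>U\<close> is also a neighbourhood of a nearby point where SVEP is known, which suffices for \<open>f = 0\<close> on \<open>U\<close>\<close>
      define z where "z = complex_of_real (min e r / 2)"
      have z: "z \<noteq> 0" "cmod z < e" "cmod z < r" using e r(1) by (auto simp: z_def)
      have "(\<lambda>x. ?S \<mu> x - z *\<^sub>C x) = ?S (\<mu> + z)" by (simp add: scaleC_add_left algebra_simps fun_eq_iff)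
      then have "\<mu> + z \<notin> sigma_lf T" using r(2)[OF z(1,3)] by (simp add: sigma_lf_def)
      then have "has_SVEP_at (cadjoint T) (\<mu> + z)" using all by blast
      moreover have "\<mu> + z \<in> U" using z(2) e(2) by (auto simp: dist_norm subset_iff)
      ultimately show "\<forall>z\<in>U. f z = 0" using A unfolding has_SVEP_at_def by blast
    qed
  qed
  have "sigma_lf T = sigma_lB T \<longleftrightarrow> (\<forall>\<mu>. \<mu> \<notin> sigma_lf T \<longrightarrow> has_SVEP_at (cadjoint T) \<mu>)"
    using Browder_SVEP unfolding sigma_lf_def sigma_lB_def lower_semi_Browder_def by blast
  moreover have "(\<forall>\<mu>. \<mu> \<notin> sigma_lf T \<longrightarrow> has_SVEP_at (cadjoint T) \<mu>) \<longleftrightarrow>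
      (\<forall>\<mu>. \<mu> \<notin> sigma_plBF T \<longrightarrow> has_SVEP_at (cadjoint T) \<mu>)"
    using SVEP_spread lf_pl unfolding sigma_plBF_def by (auto simp: sigma_lf_def)
  moreover have "(\<forall>\<mu>. \<mu> \<notin> sigma_plBF T \<longrightarrow> has_SVEP_at (cadjoint T) \<mu>) \<longleftrightarrow> sigma_gDQ T = sigma_plBF T"
    using gDQ_SVEP gDQ_pl unfolding sigma_plBF_def sigma_gDQ_def by blast
  ultimately show ?thesis by blast
qed

end
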